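(* For all $\lambda>0$, $\beta>0$ and $N\ge 1$, and for all odd $K>K^*=3/\lambda$, the Markov process $\mathcal{M}_{K,N}$ (the mean-field version of the cyclic network, with total exogenous arrival rate $\lambda$ per node, service rate $1$ and swap parameter $\beta$) is transient.
   Context: Let $K\ge3$ be odd and let $C_K=\mathbb{Z}/K\mathbb{Z}$ be the cyclic graph with vertex set $V_K=\{1,\dots,K\}$, with graph distance $\mathrm{dist}$. For $N\ge1$, $C_K^N$ is the graph with node set $V_K\times\{1,\dots,N\}$, where $(v,n)$ and $(v',n')$ are adjacent iff $v,v'$ are adjacent in $C_K$. At each node $(v,n)$ there is one server with a FIFO queue, described by the finite word of the destinations of its customers, listed in order of arrival; destinations are nodes of $C_K$ (not of $C_K^N$). $\mathcal{M}_{K,N}$ is the continuous-time Markov process on the countable set of queue configurations with the following dynamics. (Arrivals) Exogenous customers arrive at each node $(v,n)$ according to independent Poisson processes of rate $\lambda$; the destination $w\in V_K$ of a customer arriving at $(v,n)$ is chosen at random at its arrival with a law depending only on $w-v$ mod $K$. (Services) Each server completes services at rate $1$ (independent exponential service times with mean 1) when its queue is nonempty. When the first customer $c$, with destination $D(c)$, of the queue at $(v,n)$ completes service, it leaves the network if $D(c)\in\{v-1,v,v+1\}$; otherwise it joins the end of the queue at node $(\tilde v,k)$, where $\tilde v$ is whichever of $v+1$ and $v-1$ is closest to $D(c)$ and $k$ is chosen uniformly from $\{1,\dots,N\}$. (Swaps) The two servers at locations $(v,n)$ and $(v+1,k)$ exchange positions (together with their whole queues) with rate $\beta/N$, independently for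 all such pairs. Transience is in the usual sense for continuous-time Markov chains on a countable state space. *)

theory Defs
  imports "HOL-Probability.Probability" "Berlekamp_Zassenhaus.Finite_Field"
begin

section \<open>Continuous-time Markov chains\<close>

text \<open>A chain on a countable type is given by its off-diagonal transition rates
  \<open>q x y\<close>, \<open>x \<noteq> y\<close>; diagonal values of \<open>q\<close> are ignored. The definitions are meant for
  rates with \<open>0 < exit_rate q x < \<infinity>\<close> for all \<open>x\<close> (no absorbing and no instantaneous states).\<close>

definition exit_rate :: "('s \<Rightarrow> 's \<Rightarrow> real) \<Rightarrow> 's \<Rightarrow> real" where
  "exit_rate q x = (\<Sum>\<^sub>\<infinity>y\<in>-{x}. q x y)"

definition jump_prob :: "('s \<Rightarrow> 's \<Rightarrow> real) \<Rightarrow> 's \<Rightarrow> 's \<Rightarrow> real" where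
  "jump_prob q x y = (if y = x then 0 else q x y / exit_rate q x)"

text \<open>Jump chain \<open>Y\<close> and holding times \<open>S\<close>, started in \<open>x\<close>. The displayed formula says that \<open>Y\<close> is
  the discrete-time Markov chain with transition matrix \<open>jump_prob q\<close> and that,
  conditionally on \<open>Y\<close>, the \<open>S i\<close> are independent and exponential with parameters
  \<open>exit_rate q (Y i)\<close>.\<close>

definition jump_holding ::
  "('s \<Rightarrow> 's \<Rightarrow> real) \<Rightarrow> 's \<Rightarrow> 'w measure \<Rightarrow> (nat \<Rightarrow> 'w \<Rightarrow> 's) \<Rightarrow> (nat \<Rightarrow> 'w \<Rightarrow> real) \<Rightarrow> bool" where
  "jump_holding q x M Y S \<longleftrightarrow>
     (\<forall>i. Y i \<in> measurable M (count_space UNIV)) \<and>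
     (\<forall>i. S i \<in> borel_measurable M) \<and>
     (\<forall>n (y :: nat \<Rightarrow> 's) (s :: nat \<Rightarrow> real). (\<forall>i. 0 \<le> s i) \<longrightarrow>
        measure M {\<omega> \<in> space M. \<forall>i\<le>n. Y i \<omega> = y i \<and> s i < S i \<omega>} =
          of_bool (y 0 = x) * (\<Prod>i<n. jump_prob q (y i) (y (Suc i))) *
          (\<Prod>i\<le>n. exp (- exit_rate q (y i) * s i)))"

text \<open>The path that stays in \<open>y n\<close> for time \<open>s n\<close>, \<open>n = 0, 1, \<dots>\<close>; after a possible explosion it
  is sent to \<open>None\<close>.\<close>

definition jump_path :: "(nat \<Rightarrow> 's) \<Rightarrow> (nat \<Rightarrow> real) \<Rightarrow> real \<Rightarrow> 's option" where
  "jump_path y s t =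
     (if \<exists>n. t < (\<Sum>i\<le>n. s i) then Some (y (LEAST n. t < (\<Sum>i\<le>n. s i))) else None)"

text \<open>Under \<open>P x\<close>, the process \<open>X\<close> is the (minimal) Markov chain with rates \<open>q\<close> started in \<open>x\<close>.\<close>

definition markov_chain_with_rates ::
  "('s \<Rightarrow> 's \<Rightarrow> real) \<Rightarrow> ('s \<Rightarrow> 'w measure) \<Rightarrow> (real \<Rightarrow> 'w \<Rightarrow> 's option) \<Rightarrow> bool" where
  "markov_chain_with_rates q P X \<longleftrightarrow>
     (\<forall>x. prob_space (P x) \<and>
        (\<exists>Y S. jump_holding q x (P x) Y S \<and>
           (AE \<omega> in P x. \<forall>t\<ge>0. X t \<omega> = jump_path (\<lambda>n. Y n \<omega>) (\<lambda>n. S n \<omega>) t)))"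

text \<open>Every state is transient: started from \<open>x\<close>, the set of times spent in \<open>x\<close> is almost surely
  bounded.\<close>

definition transient :: "('s \<Rightarrow> 'w measure) \<Rightarrow> (real \<Rightarrow> 'w \<Rightarrow> 's option) \<Rightarrow> bool" where
  "transient P X \<longleftrightarrow> (\<forall>x. AE \<omega> in P x. bdd_above {t. 0 \<le> t \<and> X t \<omega> = Some x})"


section \<open>The cyclic network\<close>

text \<open>The cyclic graph with \<open>K = CARD('k)\<close> vertices has vertex set \<open>'k mod_ring\<close>, the integers
  modulo \<open>K\<close>; the \<open>N = CARD('n)\<close> copies of a vertex are indexed by \<open>'n\<close>.\<close>

definition cycle_adj :: "'k::nontriv mod_ring \<Rightarrow> 'k mod_ring \<Rightarrow> bool" where
  "cycle_adj u v \<longleftrightarrow> v = u + 1 \<or> v = u - 1"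

definition cycle_dist :: "'k::nontriv mod_ring \<Rightarrow> 'k mod_ring \<Rightarrow> nat" where
  "cycle_dist u v = (LEAST n. (cycle_adj ^^ n) u v)"

type_synonym ('k, 'n) node = "'k mod_ring \<times> 'n"

text \<open>The queue at each node, as the list of destinations, head of the queue first.\<close>

type_synonym ('k, 'n) config = "('k, 'n) node \<Rightarrow> 'k mod_ring list"

definition arrive ::
  "('k, 'n) node \<Rightarrow> 'k mod_ring \<Rightarrow> ('k::finite, 'n::finite) config \<Rightarrow> ('k, 'n) config" where
  "arrive a w x = x(a := x a @ [w])"

text \<open>For odd \<open>K\<close> there is no tie unless \<open>D = v\<close>, in which case \<open>next_vertex\<close> is not used.\<close>

definition next_vertex :: "'k::nontriv mod_ring \<Rightarrow> 'k mod_ring \<Rightarrow> 'k mod_ring" where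
  "next_vertex v D = (if cycle_dist (v + 1) D < cycle_dist (v - 1) D then v + 1 else v - 1)"

text \<open>Service completion at the node \<open>(v, n)\<close>, where \<open>k\<close> is the copy to which the customer is sent
  if it does not leave the network. Only used for a nonempty queue at \<open>(v, n)\<close>.\<close>

definition serve ::
  "('k, 'n) node \<Rightarrow> 'n \<Rightarrow> ('k::nontriv, 'n::finite) config \<Rightarrow> ('k, 'n) config" where
  "serve a k x =
     (let v = fst a; D = hd (x a); x' = x(a := tl (x a))
      in if D \<in> {v - 1, v, v + 1} then x' else arrive (next_vertex v D, k) D x')"

definition swap ::
  "('k, 'n) node \<Rightarrow> ('k, 'n) node \<Rightarrow> ('k::finite, 'n::finite) config \<Rightarrow> ('k, 'n) config" where
  "swap a b x = x(a := x b, b := x a)"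

text \<open>Transition rates with arrival rate \<open>lam\<close>, swap parameter \<open>beta\<close> and law \<open>p\<close> of the
  displacement (destination minus arrival vertex) of exogenous customers. The uniform choice of
  the copy \<open>k\<close> splits the service rate \<open>1\<close> into \<open>N\<close> rates \<open>1 / N\<close>. For \<open>K \<ge> 3\<close> every adjacent pair
  of nodes occurs exactly once in the last sum.\<close>

definition network_rate ::
  "real \<Rightarrow> real \<Rightarrow> 'k mod_ring pmf \<Rightarrow> ('k::nontriv, 'n::finite) config \<Rightarrow> ('k, 'n) config \<Rightarrow> real" where
  "network_rate lam beta p x y =
     (\<Sum>v\<in>UNIV. \<Sum>n\<in>UNIV. \<Sum>w\<in>UNIV.
        lam * pmf p (w - v) * of_bool (y = arrive (v, n) w x)) +
     (\<Sum>v\<in>UNIV. \<Sum>n\<in>UNIV. \<Sum>k\<in>UNIV.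
        1 / real CARD('n) * of_bool (x (v, n) \<noteq> [] \<and> y = serve (v, n) k x)) +
     (\<Sum>v\<in>UNIV. \<Sum>n\<in>UNIV. \<Sum>k\<in>UNIV.
        beta / real CARD('n) * of_bool (y = swap (v, n) (v + 1, k) x))"

end

(*
  A bounded superharmonic function of the jump chain that decreases strictly along some path from
  every state makes the expected number of returns finite. Such a function is built from the queue
  lengths: follow one queue through the swaps and correct its length by the expected future effect of
  the customers waiting in the other queues. The transpositions along the edges act transitively on
  ordered pairs of nodes, so the generator of the swaps has a spectral gap on pairs. The effect of a
  customer at depth j, a j-fold resolvent, therefore differs from the stationary mean by O(rho^j).
  The corrected length H has bounded jumps, stays within a constant of the true length, and drifts
  upwards at rate close to lambda - 1 + (K - 3) / K = lambda - 3 / K > 0 once all queues are long: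
  in the mean, a server receives the customers that do not leave at once, a fraction (K - 3) / K.
  The truncated sum of exp(- theta H) over all queues is the superharmonic function.
*)
theory Submission
  imports Defs
begin

section \<open>Transience from a bounded superharmonic function\<close>

text \<open>The obstacle is that the raw length of a queue need not drift upwards, even when all
  queues are long: the destinations waiting elsewhere are arbitrary, and for a long time no customer
  may be routed to the followed queue. The swaps repair this. While a customer waits behind j
  others, its server wanders for j + 1 service times, so at its own service the positions of the
  followed queue and of its server form a nearly uniform ordered pair of distinct nodes. Taking the
  expectation at an exponential time of mean 1 is applying (I - G)^(-1), with G the generator of the
  swaps on pairs; this is where the resolvents come from. The correction only covers the next hop of
  each customer. After the hop the customer stands at the end of another queue, and if that queue
  has length at least L, its new correction is O(rho^L). This is why the drift is controlled only
  where all queues are long, and why the Lyapunov function is truncated. The gap may be tiny for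
  small beta or large N; it only determines how long the queues must be.\<close>

primrec pmf_steps :: "('s \<Rightarrow> 's pmf) \<Rightarrow> 's \<Rightarrow> nat \<Rightarrow> 's pmf" where
  "pmf_steps \<kappa> x 0 = return_pmf x"
| "pmf_steps \<kappa> x (Suc n) = bind_pmf (pmf_steps \<kappa> x n) \<kappa>"

lemma pmf_steps_add: "pmf_steps \<kappa> x (m + n) = bind_pmf (pmf_steps \<kappa> x m) (\<lambda>y. pmf_steps \<kappa> y n)"
  by (induction n) (simp_all add: bind_return_pmf' bind_assoc_pmf)

text \<open>The defining formula only measures events that fix a whole initial segment of the path.
  With thresholds \<open>s i = 0\<close> its exponential factors are 1; the early states are then
  summed out one at a time, which turns jump probabilities into steps of the kernel. The events
  \<open>0 < S i\<close> are carried along because the inequalities in the formula are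
  strict.\<close>

lemma emeasure_jump_holding_tail:
  fixes Y :: "nat \<Rightarrow> 'w \<Rightarrow> 's::countable"
  assumes M: "prob_space M" and jh: "jump_holding q x M Y S"
    and \<kappa>: "\<And>y z. pmf (\<kappa> y) z = jump_prob q y z"
    and "k \<le> n"
  shows "emeasure M {\<omega> \<in> space M. (\<forall>i\<le>n. 0 < S i \<omega>) \<and> (\<forall>i\<in>{k..n}. Y i \<omega> = y i)} =
    ennreal (pmf (pmf_steps \<kappa> x k) (y k) * (\<Prod>i=k..<n. jump_prob q (y i) (y (Suc i))))"
  using \<open>k \<le> n\<close>
proof (induction k arbitrary: y)
  case 0
  interpret prob_space M by fact
  have "{\<omega> \<in> space M. (\<forall>i\<le>n. 0 < S i \<omega>) \<and> (\<forall>i\<in>{0..n}. Y i \<omega> = y i)} =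
      {\<omega> \<in> space M. \<forall>i\<le>n. Y i \<omega> = y i \<and> 0 < S i \<omega>}"
    by auto
  moreover have "measure M {\<omega> \<in> space M. \<forall>i\<le>n. Y i \<omega> = y i \<and> 0 < S i \<omega>} =
      of_bool (y 0 = x) * (\<Prod>i<n. jump_prob q (y i) (y (Suc i)))"
    using jh[unfolded jump_holding_def, THEN conjunct2, THEN conjunct2, rule_format,
        of "\<lambda>_. 0" n y] by simp
  ultimately show ?case
    by (simp add: emeasure_eq_measure pmf_return indicator_def lessThan_atLeast0)
next
  case (Suc k)
  interpret prob_space M by fact
  have Y[measurable]: "Y i \<in> measurable M (count_space UNIV)" for i
    using jh by (simp add: jump_holding_def)
  have S[measurable]: "S i \<in> borel_measurable M" for i
    using jh by (simp add: jump_holding_def)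
  define A where "A = (\<lambda>w. {\<omega> \<in> space M. (\<forall>i\<le>n. 0 < S i \<omega>) \<and>
    (\<forall>i\<in>{k..n}. Y i \<omega> = (y(k := w)) i)})"
  define rest where "rest = (\<Prod>i=Suc k..<n. jump_prob q (y i) (y (Suc i)))"
  have \<kappa>0: "0 \<le> jump_prob q u v" for u v
    using pmf_nonneg[of "\<kappa> u" v] by (simp only: \<kappa>)
  have rest0: "0 \<le> rest"
    unfolding rest_def by (intro prod_nonneg \<kappa>0)
  have split: "{k..n} = insert k {Suc k..n}"
    using Suc.prems by auto
  have "{\<omega> \<in> space M. (\<forall>i\<le>n. 0 < S i \<omega>) \<and> (\<forall>i\<in>{Suc k..n}. Y i \<omega> = y i)} = (\<Union>w. A w)"
    by (auto simp: A_def split)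
  moreover have "emeasure M (\<Union>w. A w) = (\<integral>\<^sup>+w. emeasure M (A w) \<partial>count_space UNIV)"
  proof (rule emeasure_UN_countable)
    show "A w \<in> sets M" for w
      unfolding A_def by measurable
    show "disjoint_family A"
      by (auto simp: disjoint_family_on_def A_def split)
  qed auto
  moreover have "emeasure M (A w) = ennreal (pmf (pmf_steps \<kappa> x k) w) * ennreal (pmf (\<kappa> w) (y (Suc k)) * rest)" for w
  proof -
    have "emeasure M (A w) = ennreal (pmf (pmf_steps \<kappa> x k) ((y(k := w)) k) *
        (\<Prod>i=k..<n. jump_prob q ((y(k := w)) i) ((y(k := w)) (Suc i))))"
      unfolding A_def using Suc.prems by (intro Suc.IH) auto
    also have "(\<Prod>i=k..<n. jump_prob q ((y(k := w)) i) ((y(k := w)) (Suc i))) =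
        jump_prob q w (y (Suc k)) * rest"
      using Suc.prems
      by (subst prod.atLeast_Suc_lessThan) (auto simp: rest_def intro!: prod.cong)
    finally show ?thesis
      by (simp add: \<kappa> ennreal_mult' mult.assoc)
  qed
  moreover have "(\<integral>\<^sup>+w. ennreal (pmf (pmf_steps \<kappa> x k) w) * ennreal (pmf (\<kappa> w) (y (Suc k)) * rest) \<partial>count_space UNIV) =
     (\<integral>\<^sup>+w. ennreal (pmf (\<kappa> w) (y (Suc k))) * ennreal rest \<partial>measure_pmf (pmf_steps \<kappa> x k))"
    by (subst nn_integral_measure_pmf) (simp add: ennreal_mult' rest0 mult.commute)
  moreover have "\<dots> = ennreal (pmf (pmf_steps \<kappa> x (Suc k)) (y (Suc k)) * rest)"
    by (simp add: nn_integral_multc ennreal_pmf_bind ennreal_mult' rest0)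
  ultimately show ?case
    by (simp only: rest_def)
qed

lemma emeasure_jump_holding_at:
  fixes Y :: "nat \<Rightarrow> 'w \<Rightarrow> 's::countable"
  assumes M: "prob_space M" and jh: "jump_holding q x M Y S"
    and \<kappa>: "\<And>y z. pmf (\<kappa> y) z = jump_prob q y z"
  shows "emeasure M {\<omega> \<in> space M. Y n \<omega> = z} = ennreal (pmf (pmf_steps \<kappa> x n) z)"
proof -
  interpret prob_space M by fact
  have Y[measurable]: "Y i \<in> measurable M (count_space UNIV)" for i
    using jh by (simp add: jump_holding_def)
  have S[measurable]: "S i \<in> borel_measurable M" for i
    using jh by (simp add: jump_holding_def)
  define A where "A = (\<lambda>w. {\<omega> \<in> space M. (\<forall>i\<le>n. 0 < S i \<omega>) \<and> (\<forall>i\<in>{n..n}. Y i \<omega> = w)})"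
  have A: "emeasure M (A w) = ennreal (pmf (pmf_steps \<kappa> x n) w)" for w
    using emeasure_jump_holding_tail[OF assms order.refl, where y="\<lambda>_. w"] by (simp add: A_def)
  have [measurable]: "A w \<in> sets M" for w
    unfolding A_def by measurable
  have "emeasure M (\<Union>w. A w) = (\<integral>\<^sup>+w. emeasure M (A w) \<partial>count_space UNIV)"
    by (rule emeasure_UN_countable) (auto simp: disjoint_family_on_def A_def)
  also have "\<dots> = 1"
    unfolding A by (simp add: nn_integral_pmf_eq_1)
  finally have "prob (\<Union>w. A w) = 1"
    by (simp add: emeasure_eq_measure)
  then have "AE \<omega> in M. \<omega> \<in> (\<Union>w. A w)"
    by (subst (asm) prob_eq_1) auto
  then have "AE \<omega> in M. (\<omega> \<in> {\<omega> \<in> space M. Y n \<omega> = z}) = (\<omega> \<in> A z)"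
    by eventually_elim (auto simp: A_def)
  then have "emeasure M {\<omega> \<in> space M. Y n \<omega> = z} = emeasure M (A z)"
    by (intro emeasure_eq_AE) auto
  then show ?thesis by (simp add: A)
qed

lemma integral_pmf_steps_Suc:
  fixes u :: "'s \<Rightarrow> real" and \<kappa> :: "'s \<Rightarrow> 's pmf"
  assumes "\<And>y. \<bar>u y\<bar> \<le> B"
  shows "(\<integral>y. u y \<partial>pmf_steps \<kappa> x (m + n)) =
    (\<integral>y. (\<integral>z. u z \<partial>pmf_steps \<kappa> y n) \<partial>pmf_steps \<kappa> x m)"
  unfolding pmf_steps_add measure_pmf_bind
  by (rule integral_bind[where K="count_space UNIV" and B=B and B'=1])
    (use assms in \<open>auto simp: measure_pmf.emeasure_space_1 intro: measure_pmf_in_subprob_algebra\<close>)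

text \<open>Let E_n be the expectation of \<open>u\<close> after n steps. A visit to
  \<open>x\<close> at time n makes E_(n+m) smaller than E_n by at least the fixed amount
  \<open>u x\<close> - E_m(x) > 0, and E_(n+m) never exceeds E_n. Telescoping with step
  \<open>m\<close> bounds the total loss by \<open>m * B\<close>, hence also the expected number of
  visits.\<close>

lemma summable_return_prob:
  fixes u :: "'s \<Rightarrow> real" and \<kappa> :: "'s \<Rightarrow> 's pmf"
  assumes u: "\<And>y. 0 \<le> u y" "\<And>y. u y \<le> B"
    and super: "\<And>y. (\<integral>z. u z \<partial>\<kappa> y) \<le> u y"
    and strict: "(\<integral>z. u z \<partial>pmf_steps \<kappa> x m) < u x"
  shows "summable (\<lambda>n. pmf (pmf_steps \<kappa> x n) x)"
proof -
  define E where "E = (\<lambda>n y. \<integral>z. u z \<partial>pmf_steps \<kappa> y n)"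
  have ab: "\<bar>u y\<bar> \<le> B" for y using u[of y] by auto
  have int[simp]: "integrable (measure_pmf r) u" for r
    by (rule measure_pmf.integrable_const_bound[where B=B]) (use ab in auto)
  have E_bounds: "0 \<le> E n y" "E n y \<le> B" for n y
  proof -
    show "0 \<le> E n y" unfolding E_def using u by (intro Bochner_Integration.integral_nonneg) auto
    show "E n y \<le> B" unfolding E_def using u
      by (intro measure_pmf.integral_le_const) auto
  qed
  have intE[simp]: "integrable (measure_pmf r) (E n)" for r n
    by (rule measure_pmf.integrable_const_bound[where B=B]) (use E_bounds in auto)
  have E_le: "E n y \<le> u y" for n y
  proof (induction n)
    case (Suc n)
    have E1: "E (Suc 0) w = (\<integral>z. u z \<partial>\<kappa> w)" for w
      by (simp add: E_def bind_return_pmf)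
    have "E (n + 1) y = (\<integral>w. E 1 w \<partial>pmf_steps \<kappa> y n)"
      unfolding E_def by (rule integral_pmf_steps_Suc[OF ab])
    also have "\<dots> \<le> (\<integral>w. u w \<partial>pmf_steps \<kappa> y n)"
      by (rule Bochner_Integration.integral_mono[OF intE int]) (simp add: E1 super)
    also have "\<dots> \<le> u y" using Suc by (simp add: E_def)
    finally show ?case by simp
  qed (simp add: E_def)
  define d where "d = u x - E m x"
  have "0 < d" using strict by (simp add: d_def E_def)
  have step: "pmf (pmf_steps \<kappa> x n) x * d \<le> E n x - E (n + m) x" for n
  proof -
    have "E n x - E (n + m) x = (\<integral>w. u w - E m w \<partial>pmf_steps \<kappa> x n)"
      using integral_pmf_steps_Suc[OF ab, of \<kappa> x n m]
      by (subst Bochner_Integration.integral_diff[OF int intE]) (simp add: E_def)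
    also have "\<dots> \<ge> (\<integral>w. d * indicator {x} w \<partial>pmf_steps \<kappa> x n)"
    proof (rule Bochner_Integration.integral_mono)
      show "integrable (measure_pmf (pmf_steps \<kappa> x n)) (\<lambda>w. d * indicator {x} w)"
        using \<open>0 < d\<close> by (intro measure_pmf.integrable_const_bound[where B=d]) (auto simp: indicator_def)
    qed (auto simp: d_def E_le indicator_def)
    also have "(\<integral>w. d * indicator {x} w \<partial>pmf_steps \<kappa> x n) = pmf (pmf_steps \<kappa> x n) x * d"
      by (simp add: pmf.rep_eq)
    finally show ?thesis .
  qed
  \<comment> \<open>Both sides become the sum over n < N + m after adding the same terms. The
    right-hand side has \<open>m\<close> terms whatever \<open>N\<close> is.\<close>
  have tele: "(\<Sum>n<N. E n x - E (n + m) x) = (\<Sum>n<m. E n x - E (n + N) x)" for N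
  proof -
    have sum_add: "(\<Sum>n<i + j. f n) = (\<Sum>n<i. f n) + (\<Sum>n<j. f (n + i))" for f :: "nat \<Rightarrow> real" and i j
      by (induction j) (simp_all add: add_ac)
    have "(\<Sum>n<N. E n x) + (\<Sum>n<m. E (n + N) x) = (\<Sum>n<m. E n x) + (\<Sum>n<N. E (n + m) x)"
      using sum_add[of "\<lambda>n. E n x" N m] sum_add[of "\<lambda>n. E n x" m N] by (simp add: add.commute)
    then show ?thesis by (simp add: sum_subtractf)
  qed
  have "(\<Sum>n<N. pmf (pmf_steps \<kappa> x n) x) \<le> real m * B / d" for N
  proof -
    have "(\<Sum>n<N. pmf (pmf_steps \<kappa> x n) x) * d \<le> (\<Sum>n<N. E n x - E (n + m) x)"
      unfolding sum_distrib_right by (intro sum_mono step)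
    also have "\<dots> \<le> (\<Sum>n<m. B)"
      unfolding tele using E_bounds by (intro sum_mono) (smt (verit))
    finally show ?thesis using \<open>0 < d\<close> by (simp add: field_simps)
  qed
  then show ?thesis
    by (intro summableI_nonneg_bounded) auto
qed

text \<open>A time spent in \<open>x\<close> lies below the partial sum that ends some visit to
  \<open>x\<close>, and there are finitely many visits. Absolute values make the bound valid for
  holding times of any sign.\<close>

lemma bdd_above_jump_path:
  assumes "finite {n. y n = x}"
  shows "bdd_above {t. 0 \<le> t \<and> jump_path y s t = Some x}"
proof (rule bdd_aboveI)
  fix t assume t: "t \<in> {t. 0 \<le> t \<and> jump_path y s t = Some x}"
  define n where "n = (LEAST n. t < (\<Sum>i\<le>n. s i))"
  have ex: "\<exists>n. t < (\<Sum>i\<le>n. s i)" and "y n = x"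
    using t by (auto simp: jump_path_def n_def split: if_splits)
  have "t < (\<Sum>i\<le>n. s i)"
    unfolding n_def using ex by (rule LeastI_ex)
  also have "\<dots> \<le> (\<Sum>i\<le>n. \<bar>s i\<bar>)"
    by (intro sum_mono) auto
  also have "\<dots> \<le> (\<Sum>n | y n = x. \<Sum>i\<le>n. \<bar>s i\<bar>)"
    using assms \<open>y n = x\<close> by (intro member_le_sum) (auto intro: sum_nonneg)
  finally show "t \<le> (\<Sum>n | y n = x. \<Sum>i\<le>n. \<bar>s i\<bar>)" by simp
qed

lemma transient_if_superharmonic:
  fixes q :: "'s::countable \<Rightarrow> 's \<Rightarrow> real" and u :: "'s \<Rightarrow> real"
  assumes chain: "markov_chain_with_rates q P X"
    and \<kappa>: "\<And>y z. pmf (\<kappa> y) z = jump_prob q y z"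
    and u: "\<And>y. 0 \<le> u y" "\<And>y. u y \<le> B"
    and super: "\<And>y. (\<integral>z. u z \<partial>\<kappa> y) \<le> u y"
    and strict: "\<And>x. \<exists>m. (\<integral>z. u z \<partial>pmf_steps \<kappa> x m) < u x"
  shows "transient P X"
  unfolding transient_def
proof
  fix x
  obtain Y S where M: "prob_space (P x)" and jh: "jump_holding q x (P x) Y S"
    and X: "AE \<omega> in P x. \<forall>t\<ge>0. X t \<omega> = jump_path (\<lambda>n. Y n \<omega>) (\<lambda>n. S n \<omega>) t"
    using chain unfolding markov_chain_with_rates_def by meson
  interpret prob_space "P x" by fact
  have Y[measurable]: "Y i \<in> measurable (P x) (count_space UNIV)" for i
    using jh by (simp add: jump_holding_def)
  obtain m where "(\<integral>z. u z \<partial>pmf_steps \<kappa> x m) < u x"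
    using strict by blast
  then have "summable (\<lambda>n. pmf (pmf_steps \<kappa> x n) x)"
    using summable_return_prob[of u B \<kappa>] u super by blast
  moreover have "measure (P x) {\<omega> \<in> space (P x). Y n \<omega> = x} = pmf (pmf_steps \<kappa> x n) x" for n
    using emeasure_jump_holding_at[OF M jh \<kappa>, of n x] by (simp add: emeasure_eq_measure)
  ultimately have "AE \<omega> in P x. eventually (\<lambda>n. \<omega> \<in> space (P x) - {\<omega> \<in> space (P x). Y n \<omega> = x}) sequentially"
    by (intro borel_cantelli_AE1) (auto simp: less_top[symmetric])
  with X show "AE \<omega> in P x. bdd_above {t. 0 \<le> t \<and> X t \<omega> = Some x}"
  proof eventually_elim
    case (elim \<omega>)
    then obtain n0 where "\<And>n. n \<ge> n0 \<Longrightarrow> Y n \<omega> \<noteq> x"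
      by (auto simp: eventually_sequentially)
    then have "{n. Y n \<omega> = x} \<subseteq> {..n0}"
      by (metis (mono_tags, lifting) mem_Collect_eq atMost_iff nle_le subsetI)
    then have "finite {n. Y n \<omega> = x}"
      by (rule finite_subset) simp
    then have "bdd_above {t. 0 \<le> t \<and> jump_path (\<lambda>n. Y n \<omega>) (\<lambda>n. S n \<omega>) t = Some x}"
      by (rule bdd_above_jump_path)
    moreover have "{t. 0 \<le> t \<and> X t \<omega> = Some x} =
        {t. 0 \<le> t \<and> jump_path (\<lambda>n. Y n \<omega>) (\<lambda>n. S n \<omega>) t = Some x}"
      using elim(1) by auto
    ultimately show ?case by simp
  qed
qed

section \<open>Chains driven by finitely many moves\<close>

definition move_rel :: "('i \<Rightarrow> 's \<Rightarrow> real) \<Rightarrow> ('i \<Rightarrow> 's \<Rightarrow> 's) \<Rightarrow> ('s \<times> 's) set" where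
  "move_rel r f = {(x, y). \<exists>i. 0 < r i x \<and> y = f i x \<and> y \<noteq> x}"

text \<open>Below the cap \<open>B\<close> the expectation of \<open>u\<close> drops strictly in one
  jump. At the cap the drop is obtained after several jumps, along the path provided by
  \<open>reach\<close>. Several moves may lead to the same state, and a move may fix the state, as
  the swap of two equal queues does; the latter adds zero to the drift sum.\<close>

lemma transient_finite_moves:
  fixes f :: "'i::finite \<Rightarrow> 's::countable \<Rightarrow> 's" and r :: "'i \<Rightarrow> 's \<Rightarrow> real" and u :: "'s \<Rightarrow> real"
  assumes chain: "markov_chain_with_rates q P X"
    and q: "\<And>x y. q x y = (\<Sum>i\<in>UNIV. r i x * of_bool (y = f i x))"
    and r: "\<And>i x. 0 \<le> r i x"
    and move: "\<And>x. \<exists>i. 0 < r i x \<and> f i x \<noteq> x"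
    and u: "\<And>x. 0 \<le> u x" "\<And>x. u x \<le> B"
    and super: "\<And>x. (\<Sum>i\<in>UNIV. r i x * (u (f i x) - u x)) \<le> 0"
    and strict: "\<And>x. u x < B \<Longrightarrow> (\<Sum>i\<in>UNIV. r i x * (u (f i x) - u x)) < 0"
    and reach: "\<And>x. \<exists>y. (x, y) \<in> (move_rel r f)\<^sup>* \<and> u y < B"
  shows "transient P X"
proof -
  define A where "A = (\<lambda>x. range (\<lambda>i. f i x) - {x})"
  have finA[simp]: "finite (A x)" for x by (simp add: A_def)
  have q0: "0 \<le> q x y" for x y unfolding q by (intro sum_nonneg) (simp add: r)
  have q_out: "q x y = 0" if "y \<notin> A x" "y \<noteq> x" for x y
    unfolding q using that by (intro sum.neutral) (auto simp: A_def)
  have q_pos: "0 < q x (f i x)" if "0 < r i x" for x i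
  proof -
    have "r i x * of_bool (f i x = f i x) \<le> q x (f i x)"
      unfolding q by (rule member_le_sum) (auto simp: r)
    with that show ?thesis by simp
  qed
  have exit: "exit_rate q x = (\<Sum>y\<in>A x. q x y)" for x
  proof -
    have "exit_rate q x = (\<Sum>\<^sub>\<infinity>y\<in>A x. q x y)"
      unfolding exit_rate_def by (rule infsum_cong_neutral) (use q_out in \<open>auto simp: A_def\<close>)
    then show ?thesis by simp
  qed
  have exit_pos: "0 < exit_rate q x" for x
  proof -
    obtain i where i: "0 < r i x" "f i x \<noteq> x" using move by blast
    have "q x (f i x) \<le> (\<Sum>y\<in>A x. q x y)"
      by (rule member_le_sum) (use i in \<open>auto simp: A_def q0\<close>)
    with q_pos[OF i(1)] show ?thesis by (simp add: exit)
  qed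
  have jp0: "0 \<le> jump_prob q x y" for x y
    using exit_pos[of x] q0[of x y] by (simp add: jump_prob_def)
  have jp_out: "jump_prob q x y = 0" if "y \<notin> A x" for x y
    using q_out[OF that] by (simp add: jump_prob_def)
  have jp_sum: "(\<Sum>y\<in>A x. jump_prob q x y) = 1" for x
  proof -
    have "(\<Sum>y\<in>A x. jump_prob q x y) = (\<Sum>y\<in>A x. q x y / exit_rate q x)"
      by (rule sum.cong) (auto simp: jump_prob_def A_def)
    also have "\<dots> = 1"
      using exit_pos[of x] by (simp add: exit flip: sum_divide_distrib)
    finally show ?thesis .
  qed
  define \<kappa> where "\<kappa> = (\<lambda>x. embed_pmf (jump_prob q x))"
  have \<kappa>: "pmf (\<kappa> x) y = jump_prob q x y" for x y
    unfolding \<kappa>_def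
  proof (rule pmf_embed_pmf)
    have "(\<integral>\<^sup>+y. ennreal (jump_prob q x y) \<partial>count_space UNIV) = (\<Sum>y\<in>A x. ennreal (jump_prob q x y))"
      by (rule nn_integral_count_space') (use jp_out in auto)
    also have "\<dots> = 1" using jp_sum[of x] by (simp add: jp0 sum_ennreal)
    finally show "(\<integral>\<^sup>+y. ennreal (jump_prob q x y) \<partial>count_space UNIV) = 1" .
  qed (rule jp0)
  have expect: "(\<integral>z. v z \<partial>\<kappa> x) = (\<Sum>z\<in>A x. v z * jump_prob q x z)" for v :: "'s \<Rightarrow> real" and x
    by (subst integral_measure_pmf_real[of "A x"]) (use jp_out in \<open>auto simp: \<kappa> set_pmf_iff\<close>)
  have drift: "(\<integral>z. u z \<partial>\<kappa> x) - u x = (\<Sum>i\<in>UNIV. r i x * (u (f i x) - u x)) / exit_rate q x" for x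
  proof -
    have "(\<integral>z. u z \<partial>\<kappa> x) - u x = (\<Sum>z\<in>A x. (u z - u x) * jump_prob q x z)"
      by (simp add: expect left_diff_distrib sum_subtractf jp_sum flip: sum_distrib_left)
    also have "\<dots> = (\<Sum>z\<in>A x. (u z - u x) * q x z) / exit_rate q x"
      unfolding sum_divide_distrib by (rule sum.cong) (auto simp: jump_prob_def A_def)
    also have "(\<Sum>z\<in>A x. (u z - u x) * q x z) = (\<Sum>z\<in>range (\<lambda>i. f i x). (u z - u x) * q x z)"
      by (rule sum.mono_neutral_left) (auto simp: A_def)
    also have "\<dots> = (\<Sum>i\<in>UNIV. \<Sum>z\<in>range (\<lambda>i. f i x). r i x * (of_bool (z = f i x) * (u z - u x)))"
      unfolding q sum_distrib_left by (subst sum.swap) (simp add: mult_ac)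
    also have "\<dots> = (\<Sum>i\<in>UNIV. r i x * (u (f i x) - u x))"
    proof (rule sum.cong)
      fix i
      have "(\<Sum>z\<in>range (\<lambda>i. f i x). r i x * (of_bool (z = f i x) * (u z - u x))) =
          (\<Sum>z\<in>{f i x}. r i x * (of_bool (z = f i x) * (u z - u x)))"
        by (rule sum.mono_neutral_right) auto
      then show "(\<Sum>z\<in>range (\<lambda>i. f i x). r i x * (of_bool (z = f i x) * (u z - u x))) =
          r i x * (u (f i x) - u x)" by simp
    qed simp
    finally show ?thesis .
  qed
  have ab: "\<bar>u y\<bar> \<le> B" for y using u[of y] by auto
  have int_le: "(\<integral>z. u z \<partial>pmf_steps \<kappa> x m) \<le> B" for x m
    by (intro measure_pmf.integral_le_const measure_pmf.integrable_const_bound[where B=B])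
      (use u ab in auto)
  \<comment> \<open>Induction backwards along the path: with positive probability one jump leads to
    a state whose later expectation is below \<open>B\<close>, and from all other states that
    expectation is at most \<open>B\<close>.\<close>
  have below: "\<exists>m. (\<integral>z. u z \<partial>pmf_steps \<kappa> x m) < B" for x
  proof -
    obtain y where "(x, y) \<in> (move_rel r f)\<^sup>*" "u y < B" using reach by blast
    then show ?thesis
    proof (induction rule: converse_rtrancl_induct)
      case base
      then show ?case by (intro exI[of _ 0]) simp
    next
      case (step x z)
      then obtain m where m: "(\<integral>z. u z \<partial>pmf_steps \<kappa> z m) < B" by blast
      obtain i where i: "0 < r i x" "z = f i x" "z \<noteq> x" using step by (auto simp: move_rel_def)
      have "z \<in> A x" "0 < jump_prob q x z"
        using i q_pos[of i x] exit_pos[of x] by (auto simp: A_def jump_prob_def)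
      have "(\<integral>z. u z \<partial>pmf_steps \<kappa> x (1 + m)) = (\<integral>y. (\<integral>z. u z \<partial>pmf_steps \<kappa> y m) \<partial>pmf_steps \<kappa> x 1)"
        by (rule integral_pmf_steps_Suc[OF ab])
      also have "\<dots> = (\<integral>y. (\<integral>z. u z \<partial>pmf_steps \<kappa> y m) \<partial>\<kappa> x)"
        by (simp add: bind_return_pmf)
      also have "\<dots> < (\<Sum>y\<in>A x. B * jump_prob q x y)"
        unfolding expect
        using \<open>z \<in> A x\<close> \<open>0 < jump_prob q x z\<close> m
        by (intro sum_strict_mono_ex1) (auto intro!: mult_right_mono int_le jp0 bexI[of _ z])
      also have "\<dots> = B" by (simp add: jp_sum flip: sum_distrib_left)
      finally show ?case by blast
    qed
  qed
  show ?thesis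
  proof (rule transient_if_superharmonic[OF chain \<kappa> u])
    show "(\<integral>z. u z \<partial>\<kappa> x) \<le> u x" for x
      using drift[of x] super[of x] exit_pos[of x] divide_nonpos_pos[OF super[of x] exit_pos[of x]] by linarith
    show "\<exists>m. (\<integral>z. u z \<partial>pmf_steps \<kappa> x m) < u x" for x
    proof (cases "u x < B")
      case True
      have "(\<integral>z. u z \<partial>\<kappa> x) < u x"
        using drift[of x] divide_neg_pos[OF strict[OF True] exit_pos[of x]] by linarith
      then show ?thesis by (intro exI[of _ 1]) (simp add: bind_return_pmf)
    next
      case False
      with u(2)[of x] below[of x] show ?thesis by auto
    qed
  qed
qed

section \<open>Transience from a drift condition\<close>

text \<open>For negative z, (1 - z)(1 + z + z^2) = 1 - z^3 is at least 1, while exp z is at most 1 /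
  (1 - z).\<close>

lemma exp_le_quadratic:
  fixes z :: real
  assumes "z \<le> 1"
  shows "exp z \<le> 1 + z + z\<^sup>2"
proof (cases "0 \<le> z")
  case True
  with assms show ?thesis by (intro exp_bound)
next
  case False
  have "1 \<le> (1 - z) * (1 + z + z\<^sup>2)"
    using False mult_nonpos_nonneg[of z "z * z"] by (simp add: algebra_simps power2_eq_square)
  moreover have "1 \<le> (1 - z) * (1 + z + z\<^sup>2) \<Longrightarrow> exp z * (1 - z) \<le> (1 + z + z\<^sup>2) * (1 - z)"
  proof -
    assume *: "1 \<le> (1 - z) * (1 + z + z\<^sup>2)"
    have "exp z * (1 - z) \<le> exp z * exp (- z)"
      using exp_ge_add_one_self[of "- z"] by (intro mult_left_mono) auto
    also have "\<dots> = 1" by (simp flip: exp_add)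
    finally show ?thesis using * by (simp add: mult.commute)
  qed
  ultimately show ?thesis using False by (simp add: mult_le_cancel_right)
qed

text \<open>Each coordinate \<open>H x a\<close> drifts to infinity, provided that the coordinates are relabelled by \<open>\<pi> i\<close>
  whenever the move \<open>i\<close> is made. The Lyapunov function is the symmetric function
  \<open>\<Sum>a. exp (- \<theta> * H x a)\<close>, truncated at the level below which the drift is known.\<close>

lemma transient_if_drift:
  fixes f :: "'i::finite \<Rightarrow> 's::countable \<Rightarrow> 's" and r :: "'i \<Rightarrow> 's \<Rightarrow> real"
    and H :: "'s \<Rightarrow> 'a::finite \<Rightarrow> real" and \<pi> :: "'i \<Rightarrow> 'a \<Rightarrow> 'a"
  assumes chain: "markov_chain_with_rates q P X"
    and q: "\<And>x y. q x y = (\<Sum>i\<in>UNIV. r i x * of_bool (y = f i x))"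
    and r: "\<And>i x. 0 \<le> r i x" and R: "\<And>x. (\<Sum>i\<in>UNIV. r i x) \<le> R"
    and move: "\<And>x. \<exists>i. 0 < r i x \<and> f i x \<noteq> x"
    and \<pi>: "\<And>i. bij (\<pi> i)"
    and J: "\<And>i x a. 0 < r i x \<Longrightarrow> \<bar>H (f i x) (\<pi> i a) - H x a\<bar> \<le> J"
    and \<delta>: "0 < \<delta>"
    and drift: "\<And>x a. (\<And>b. hmin \<le> H x b) \<Longrightarrow> \<delta> \<le> (\<Sum>i\<in>UNIV. r i x * (H (f i x) (\<pi> i a) - H x a))"
    and reach: "\<And>h x. \<exists>y. (x, y) \<in> (move_rel r f)\<^sup>* \<and> (\<forall>a. h \<le> H y a)"
  shows "transient P X"
proof -
  have "0 \<le> J"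
    using J move by (meson abs_ge_zero order.trans)
  have "0 \<le> R"
    using R r by (meson order.trans sum_nonneg)
  \<comment> \<open>\<open>C\<close> dominates \<open>R * J\<^sup>2\<close> and is positive even if
    \<open>R\<close> or \<open>J\<close> is 0. Then \<open>\<theta>\<close> is small enough both for
    the quadratic bound on exp and for keeping the second-order term at most half of the drift
    \<open>\<delta>\<close>.\<close>
  define C where "C = (1 + R) * (1 + J)\<^sup>2"
  have C: "0 < C" "R * J\<^sup>2 \<le> C"
    unfolding C_def using \<open>0 \<le> J\<close> \<open>0 \<le> R\<close> by (auto intro!: mult_mono power_mono)
  define \<theta> where "\<theta> = min (1 / (1 + J)) (\<delta> / (2 * C))"
  have \<theta>: "0 < \<theta>" "\<theta> * J \<le> 1" "\<theta> * (R * J\<^sup>2) < \<delta>"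
  proof -
    show "0 < \<theta>" using \<open>0 \<le> J\<close> C \<delta> by (simp add: \<theta>_def)
    have "\<theta> * J \<le> 1 / (1 + J) * J" using \<open>0 \<le> J\<close> by (intro mult_right_mono) (auto simp: \<theta>_def)
    also have "\<dots> \<le> 1" using \<open>0 \<le> J\<close> by (simp add: field_simps)
    finally show "\<theta> * J \<le> 1" .
    have "\<theta> * (R * J\<^sup>2) \<le> \<delta> / (2 * C) * C"
      using C \<delta> \<open>0 \<le> R\<close> by (intro mult_mono) (auto simp: \<theta>_def)
    also have "\<dots> = \<delta> / 2"
      using C by simp
    also have "\<dots> < \<delta>" using \<delta> by simp
    finally show "\<theta> * (R * J\<^sup>2) < \<delta>" .
  qed
  define F where "F = (\<lambda>x. \<Sum>a\<in>UNIV. exp (- \<theta> * H x a))"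
  \<comment> \<open>Each exponential in \<open>F x\<close> is positive, so \<open>F x < B\<close>
    forces every coordinate above \<open>hmin\<close> at once; this is exactly the region where
    \<open>drift\<close> applies.\<close>
  define B where "B = exp (- \<theta> * hmin)"
  define u where "u = (\<lambda>x. min (F x) B)"
  have F_pos: "0 < F x" for x
    unfolding F_def by (intro sum_pos) auto
  have F_move: "F (f i x) = (\<Sum>a\<in>UNIV. exp (- \<theta> * H (f i x) (\<pi> i a)))" for i x
    unfolding F_def by (rule sum.reindex_bij_betw[OF \<pi>, symmetric])
  have H_large: "hmin \<le> H x a" if "F x < B" for x a
  proof -
    have "exp (- \<theta> * H x a) \<le> F x" unfolding F_def by (rule member_le_sum) auto
    with that have "exp (- \<theta> * H x a) < exp (- \<theta> * hmin)" unfolding B_def by linarith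
    then have "\<theta> * hmin < \<theta> * H x a" by simp
    with \<theta>(1) show ?thesis by simp
  qed
  have F_drift: "(\<Sum>i\<in>UNIV. r i x * (F (f i x) - F x)) < 0" if "F x < B" for x
  proof -
    define \<Delta> where "\<Delta> = (\<lambda>i a. H (f i x) (\<pi> i a) - H x a)"
    have one: "r i x * exp (- \<theta> * \<Delta> i a) \<le> r i x * (1 - \<theta> * \<Delta> i a + \<theta>\<^sup>2 * J\<^sup>2)" for i a
    proof (cases "r i x = 0")
      case False
      with r[of i x] have "0 < r i x" by simp
      from J[OF this] have \<Delta>J: "\<bar>\<Delta> i a\<bar> \<le> J" by (simp add: \<Delta>_def)
      have "\<theta> * (- \<Delta> i a) \<le> \<theta> * J"
        using \<Delta>J \<theta>(1) by (intro mult_left_mono) auto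
      then have "exp (- \<theta> * \<Delta> i a) \<le> 1 + (- \<theta> * \<Delta> i a) + (- \<theta> * \<Delta> i a)\<^sup>2"
        using \<theta>(2) by (intro exp_le_quadratic) linarith
      also have "(- \<theta> * \<Delta> i a)\<^sup>2 \<le> \<theta>\<^sup>2 * J\<^sup>2"
        using power_mono[OF \<Delta>J, of 2] by (simp add: power_mult_distrib mult_left_mono)
      finally show ?thesis using \<open>0 < r i x\<close> by simp
    qed simp
    have each: "(\<Sum>i\<in>UNIV. r i x * (exp (- \<theta> * \<Delta> i a) - 1)) < 0" for a
    proof -
      have "(\<Sum>i\<in>UNIV. r i x * (exp (- \<theta> * \<Delta> i a) - 1)) \<le>
          (\<Sum>i\<in>UNIV. \<theta>\<^sup>2 * J\<^sup>2 * r i x - \<theta> * (r i x * \<Delta> i a))"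
        using one by (intro sum_mono) (auto simp: algebra_simps)
      also have "\<dots> = \<theta>\<^sup>2 * J\<^sup>2 * (\<Sum>i\<in>UNIV. r i x) - \<theta> * (\<Sum>i\<in>UNIV. r i x * \<Delta> i a)"
        by (simp add: sum_subtractf sum_distrib_left)
      also have "\<dots> \<le> \<theta>\<^sup>2 * J\<^sup>2 * R - \<theta> * \<delta>"
        using \<theta>(1) drift[OF H_large[OF that], of a] R[of x]
        by (intro diff_mono mult_left_mono) (auto simp: \<Delta>_def)
      also have "\<dots> = \<theta> * (\<theta> * (R * J\<^sup>2) - \<delta>)"
        by (simp add: power2_eq_square right_diff_distrib mult_ac)
      also have "\<dots> < 0"
        using \<theta> by (intro mult_pos_neg) auto
      finally show ?thesis .
    qed
    have "(\<Sum>i\<in>UNIV. r i x * (F (f i x) - F x)) =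
        (\<Sum>i\<in>UNIV. \<Sum>a\<in>UNIV. exp (- \<theta> * H x a) * (r i x * (exp (- \<theta> * \<Delta> i a) - 1)))"
    proof (rule sum.cong)
      fix i
      have "exp (- \<theta> * H (f i x) (\<pi> i a)) = exp (- \<theta> * H x a) * exp (- \<theta> * \<Delta> i a)" for a
        unfolding exp_add[symmetric] by (simp add: \<Delta>_def right_diff_distrib)
      then have "F (f i x) - F x = (\<Sum>a\<in>UNIV. exp (- \<theta> * H x a) * (exp (- \<theta> * \<Delta> i a) - 1))"
        unfolding F_move by (simp add: F_def right_diff_distrib sum_subtractf)
      then show "r i x * (F (f i x) - F x) =
          (\<Sum>a\<in>UNIV. exp (- \<theta> * H x a) * (r i x * (exp (- \<theta> * \<Delta> i a) - 1)))"
        by (simp add: sum_distrib_left mult.left_commute)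
    qed simp
    also have "\<dots> = (\<Sum>a\<in>UNIV. exp (- \<theta> * H x a) * (\<Sum>i\<in>UNIV. r i x * (exp (- \<theta> * \<Delta> i a) - 1)))"
      unfolding sum_distrib_left by (rule sum.swap)
    also have "\<dots> < (\<Sum>a\<in>(UNIV :: 'a set). 0)"
      by (intro sum_strict_mono mult_pos_neg each) auto
    finally show ?thesis by simp
  qed
  show ?thesis
  proof (rule transient_finite_moves[OF chain q r move, where u=u and B=B])
    show "0 \<le> u x" "u x \<le> B" for x
      using F_pos[of x] by (auto simp: u_def B_def)
    show strict: "(\<Sum>i\<in>UNIV. r i x * (u (f i x) - u x)) < 0" if "u x < B" for x
    proof -
      from that have "F x < B" "u x = F x" by (auto simp: u_def min_def split: if_splits)
      \<comment> \<open>\<open>u\<close> equals \<open>F\<close> at the current state and is at most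
        \<open>F\<close> elsewhere, so truncation only lowers the drift.\<close>
      have "(\<Sum>i\<in>UNIV. r i x * (u (f i x) - u x)) \<le> (\<Sum>i\<in>UNIV. r i x * (F (f i x) - F x))"
        unfolding \<open>u x = F x\<close> by (intro sum_mono mult_left_mono r) (simp add: u_def)
      with F_drift[OF \<open>F x < B\<close>] show ?thesis by simp
    qed
    show "(\<Sum>i\<in>UNIV. r i x * (u (f i x) - u x)) \<le> 0" for x
    proof (cases "u x < B")
      case True
      from strict[OF this] show ?thesis by simp
    next
      case False
      then have "u (f i x) - u x \<le> 0" for i by (auto simp: u_def)
      then show ?thesis by (intro sum_nonpos mult_nonneg_nonpos r)
    qed
    show "\<exists>y. (x, y) \<in> (move_rel r f)\<^sup>* \<and> u y < B" for x
    proof -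
      \<comment> \<open>At height \<open>h\<close> each of the \<open>CARD('a)\<close> exponentials
        is at most \<open>B / (2 * CARD('a))\<close>, which puts \<open>F\<close> at or below
        \<open>B / 2\<close>.\<close>
      define h where "h = hmin + ln (2 * real CARD('a)) / \<theta>"
      obtain y where y: "(x, y) \<in> (move_rel r f)\<^sup>*" "\<And>a. h \<le> H y a" using reach by blast
      have "F y \<le> (\<Sum>a\<in>(UNIV :: 'a set). exp (- \<theta> * h))"
        unfolding F_def using y \<theta>(1) by (intro sum_mono) simp
      also have "exp (- \<theta> * h) = B / (2 * real CARD('a))"
      proof -
        have "- \<theta> * h = - \<theta> * hmin - ln (2 * real CARD('a))"
          using \<theta>(1) by (simp add: h_def distrib_left)
        then show ?thesis by (simp only: B_def exp_diff) simp
      qed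
      finally have "F y \<le> B / 2" by simp
      then have "u y < B" by (simp add: u_def B_def min_less_iff_disj)
        (use exp_gt_zero[of "- (\<theta> * hmin)"] in linarith)
      with y(1) show ?thesis by blast
    qed
  qed
qed

section \<open>The resolvent of a symmetric random walk\<close>

definition walk_gen :: "real \<Rightarrow> ('i::finite \<Rightarrow> 'v \<Rightarrow> 'v) \<Rightarrow> ('v \<Rightarrow> real) \<Rightarrow> 'v \<Rightarrow> real" where
  "walk_gen c s g v = c * (\<Sum>i\<in>UNIV. g (s i v) - g v)"

locale involution_walk =
  fixes c :: real and s :: "'i::finite \<Rightarrow> 'v::finite \<Rightarrow> 'v"
  assumes c: "0 < c" and inv: "\<And>i v. s i (s i v) = v"
begin

lemma sum_invariant:
  assumes "\<And>i v. v \<in> V \<Longrightarrow> s i v \<in> V"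
  shows "(\<Sum>v\<in>V. h (s i v)) = (\<Sum>v\<in>V. h v)"
  by (rule sum.reindex_bij_witness[of _ "s i" "s i"]) (auto simp: inv assms)

lemma sum_walk_gen:
  assumes "\<And>i v. v \<in> V \<Longrightarrow> s i v \<in> V"
  shows "(\<Sum>v\<in>V. walk_gen c s g v) = 0"
proof -
  have "(\<Sum>v\<in>V. walk_gen c s g v) = c * (\<Sum>i\<in>UNIV. \<Sum>v\<in>V. g (s i v) - g v)"
    unfolding walk_gen_def sum_distrib_left[symmetric] by (subst sum.swap) simp
  also have "\<dots> = 0"
    by (simp add: sum_subtractf sum_invariant[OF assms])
  finally show ?thesis .
qed

text \<open>Summation by parts: each \<open>s i\<close> is an involution that preserves
  \<open>V\<close>, so the generator is symmetric for counting measure on \<open>V\<close>.\<close>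

lemma dirichlet_form:
  assumes "\<And>i v. v \<in> V \<Longrightarrow> s i v \<in> V"
  shows "(\<Sum>v\<in>V. g v * (g v - walk_gen c s g v)) =
    (\<Sum>v\<in>V. (g v)\<^sup>2) + c / 2 * (\<Sum>i\<in>UNIV. \<Sum>v\<in>V. (g (s i v) - g v)\<^sup>2)"
proof -
  have "(\<Sum>v\<in>V. (g (s i v) - g v)\<^sup>2) = - 2 * (\<Sum>v\<in>V. g v * (g (s i v) - g v))" for i
  proof -
    have "(\<Sum>v\<in>V. (g (s i v) - g v)\<^sup>2) =
        (\<Sum>v\<in>V. (g (s i v))\<^sup>2) + (\<Sum>v\<in>V. (g v)\<^sup>2) - 2 * (\<Sum>v\<in>V. g v * g (s i v))"
      by (simp add: power2_diff sum.distrib sum_subtractf sum_distrib_left mult_ac)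
    also have "(\<Sum>v\<in>V. (g (s i v))\<^sup>2) = (\<Sum>v\<in>V. (g v)\<^sup>2)"
      by (rule sum_invariant[OF assms])
    finally show ?thesis
      by (simp add: right_diff_distrib sum_subtractf power2_eq_square)
  qed
  then have "(\<Sum>i\<in>UNIV. \<Sum>v\<in>V. (g (s i v) - g v)\<^sup>2) =
      - 2 * (\<Sum>i\<in>UNIV. \<Sum>v\<in>V. g v * (g (s i v) - g v))"
    by (subst sum_distrib_left) (simp only:)
  then have "c / 2 * (\<Sum>i\<in>UNIV. \<Sum>v\<in>V. (g (s i v) - g v)\<^sup>2) =
      - c * (\<Sum>i\<in>UNIV. \<Sum>v\<in>V. g v * (g (s i v) - g v))"
    by simp
  also have "\<dots> = - (\<Sum>v\<in>V. g v * walk_gen c s g v)"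
    unfolding walk_gen_def by (subst sum.swap) (simp add: sum_distrib_left mult_ac sum_negf)
  finally show ?thesis
    by (simp add: right_diff_distrib sum_subtractf power2_eq_square)
qed

text \<open>By the Dirichlet form on the whole space, I minus the generator is positive definite,
  hence injective; in finite dimension it is then surjective.\<close>

lemma resolvent_exists: "\<exists>g. \<forall>v. g v - walk_gen c s g v = f v"
proof -
  define T :: "(real, 'v) vec \<Rightarrow> (real, 'v) vec"
    where "T = (\<lambda>g. \<chi> v. g $ v - walk_gen c s (vec_nth g) v)"
  have "linear T"
    by (rule linearI)
      (auto simp: T_def walk_gen_def vec_eq_iff algebra_simps sum.distrib sum_subtractf sum_distrib_left)
  moreover have "inj T"
  proof (subst linear_injective_0[OF \<open>linear T\<close>], intro allI impI)
    fix g assume "T g = 0"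
    then have "(\<Sum>v\<in>UNIV. g $ v * (g $ v - walk_gen c s (vec_nth g) v)) = 0"
      by (simp add: T_def vec_eq_iff)
    then have "(\<Sum>v\<in>UNIV. (g $ v)\<^sup>2) + c / 2 * (\<Sum>i\<in>UNIV. \<Sum>v\<in>UNIV. (g $ (s i v) - g $ v)\<^sup>2) = 0"
      by (subst (asm) dirichlet_form) simp_all
    moreover have "0 \<le> c / 2 * (\<Sum>i\<in>UNIV. \<Sum>v\<in>UNIV. (g $ (s i v) - g $ v)\<^sup>2)"
      using c by (intro mult_nonneg_nonneg sum_nonneg) auto
    moreover have "0 \<le> (\<Sum>v\<in>UNIV. (g $ v)\<^sup>2)"
      by (intro sum_nonneg) auto
    ultimately have "(\<Sum>v\<in>UNIV. (g $ v)\<^sup>2) = 0" by linarith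
    then show "g = 0" by (simp add: sum_nonneg_eq_0_iff vec_eq_iff)
  qed
  ultimately have "surj T" by (rule eucl.linear_inj_imp_surj)
  then obtain g where "T g = vec_lambda f" by (metis surjD)
  then show ?thesis
    by (intro exI[of _ "vec_nth g"]) (simp add: T_def vec_eq_iff)
qed

text \<open>This is (I - G)^(-1) f, the expectation of f at the position of the walk after an
  independent exponential time of mean 1, that is, after one service.\<close>

definition resolvent :: "('v \<Rightarrow> real) \<Rightarrow> 'v \<Rightarrow> real" where
  "resolvent f = (SOME g. \<forall>v. g v - walk_gen c s g v = f v)"

lemma resolvent: "resolvent f v - walk_gen c s (resolvent f) v = f v"
  unfolding resolvent_def using someI_ex[OF resolvent_exists] by blast

end

text \<open>\<open>d\<close> bounds the number of steps between any two points of the invariant set \<open>V\<close>.\<close>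

locale connected_involution_walk = involution_walk +
  fixes V and d :: real
  assumes V: "\<And>i v. v \<in> V \<Longrightarrow> s i v \<in> V"
    and d: "0 < d"
    and conn: "\<And>g M v w. (\<And>i v. v \<in> V \<Longrightarrow> \<bar>g (s i v) - g v\<bar> \<le> M) \<Longrightarrow> v \<in> V \<Longrightarrow> w \<in> V \<Longrightarrow>
      \<bar>g v - g w\<bar> \<le> d * M"
begin

text \<open>A crude lower bound for the spectral gap on \<open>V\<close>, read off from the proof of
  the Poincare inequality; the summand 1 keeps the denominator positive.\<close>

definition gap :: real where
  "gap = c / (2 * d\<^sup>2 * (1 + real (card V)))"

lemma gap_pos: "0 < gap"
  using c d by (simp add: gap_def)

text \<open>A function of mean zero is, at each point, the average of its differences to all points.
  By \<open>conn\<close> such a difference is at most \<open>d\<close> times the largest increment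
  along a step, and that increment is at most the square root of the total energy.\<close>

lemma poincare:
  assumes "(\<Sum>v\<in>V. g v) = 0"
  shows "gap * (\<Sum>v\<in>V. (g v)\<^sup>2) \<le> c / 2 * (\<Sum>i\<in>UNIV. \<Sum>v\<in>V. (g (s i v) - g v)\<^sup>2)"
proof -
  define E where "E = (\<Sum>i\<in>UNIV. \<Sum>v\<in>V. (g (s i v) - g v)\<^sup>2)"
  have E0: "0 \<le> E" unfolding E_def by (intro sum_nonneg) auto
  have "\<bar>g (s i v) - g v\<bar> \<le> sqrt E" if "v \<in> V" for i v
  proof -
    have "(g (s i v) - g v)\<^sup>2 \<le> (\<Sum>v\<in>V. (g (s i v) - g v)\<^sup>2)"
      by (rule member_le_sum) (use that in auto)
    also have "\<dots> \<le> E"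
      unfolding E_def by (rule member_le_sum) (auto intro: sum_nonneg)
    finally show ?thesis by (metis real_sqrt_abs real_sqrt_le_iff)
  qed
  then have diff: "\<bar>g v - g w\<bar> \<le> d * sqrt E" if "v \<in> V" "w \<in> V" for v w
    by (rule conn) (use that in auto)
  have "(g v)\<^sup>2 \<le> d\<^sup>2 * E" if v: "v \<in> V" for v
  proof -
    have pos: "0 < real (card V)" using v by (auto simp: card_gt_0_iff)
    have "real (card V) * \<bar>g v\<bar> = \<bar>\<Sum>w\<in>V. g v - g w\<bar>"
      using assms by (simp add: sum_subtractf abs_mult)
    also have "\<dots> \<le> (\<Sum>w\<in>V. \<bar>g v - g w\<bar>)" by (rule sum_abs)
    also have "\<dots> \<le> (\<Sum>w\<in>V. d * sqrt E)" by (intro sum_mono diff v)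
    also have "\<dots> = real (card V) * (d * sqrt E)" by simp
    finally have "\<bar>g v\<bar> \<le> d * sqrt E" using pos by simp
    then have "\<bar>g v\<bar>\<^sup>2 \<le> (d * sqrt E)\<^sup>2" by (rule power_mono) simp
    then show ?thesis using E0 by (simp add: power_mult_distrib)
  qed
  then have "(\<Sum>v\<in>V. (g v)\<^sup>2) \<le> (\<Sum>v\<in>V. d\<^sup>2 * E)" by (rule sum_mono)
  also have "\<dots> \<le> (1 + real (card V)) * (d\<^sup>2 * E)"
    using E0 by (simp add: algebra_simps)
  finally have "gap * (\<Sum>v\<in>V. (g v)\<^sup>2) \<le> gap * ((1 + real (card V)) * (d\<^sup>2 * E))"
    using gap_pos by (intro mult_left_mono) auto
  also have "\<dots> = c / 2 * E"
    using d by (simp add: gap_def field_simps add_nonneg_eq_0_iff)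
  finally show ?thesis by (simp add: E_def)
qed

lemma sum_resolvent: "(\<Sum>v\<in>V. resolvent f v) = (\<Sum>v\<in>V. f v)"
proof -
  have "(\<Sum>v\<in>V. f v) = (\<Sum>v\<in>V. resolvent f v) - (\<Sum>v\<in>V. walk_gen c s (resolvent f) v)"
    unfolding sum_subtractf[symmetric] by (simp add: resolvent)
  then show ?thesis using sum_walk_gen[OF V] by simp
qed

text \<open>Pairing g - G g = f with g and inserting the Poincare inequality gives (1 + gap) |g|^2
  \<le> <g, f>, and Cauchy-Schwarz removes one factor |g|.\<close>

lemma resolvent_contraction:
  assumes "(\<Sum>v\<in>V. f v) = 0"
  shows "(1 + gap) * L2_set (resolvent f) V \<le> L2_set f V"
proof -
  define g where "g = resolvent f"
  have "(\<Sum>v\<in>V. g v) = 0" using assms by (simp add: g_def sum_resolvent)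
  have "(1 + gap) * (L2_set g V)\<^sup>2 \<le>
      (\<Sum>v\<in>V. (g v)\<^sup>2) + c / 2 * (\<Sum>i\<in>UNIV. \<Sum>v\<in>V. (g (s i v) - g v)\<^sup>2)"
    using poincare[OF \<open>(\<Sum>v\<in>V. g v) = 0\<close>]
    by (simp add: L2_set_def sum_nonneg distrib_right)
  also have "\<dots> = (\<Sum>v\<in>V. g v * f v)"
    by (subst dirichlet_form[OF V, symmetric]) (simp_all add: g_def resolvent)
  also have "\<dots> \<le> (\<Sum>v\<in>V. \<bar>g v\<bar> * \<bar>f v\<bar>)"
    by (intro sum_mono) (metis abs_ge_self abs_mult)
  also have "\<dots> \<le> L2_set g V * L2_set f V"
    by (rule L2_set_mult_ineq)
  finally have "L2_set g V * ((1 + gap) * L2_set g V) \<le> L2_set g V * L2_set f V"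
    by (simp add: power2_eq_square mult_ac)
  then show ?thesis
    using L2_set_nonneg[of g V] L2_set_nonneg[of f V] unfolding g_def
    by (cases "L2_set (resolvent f) V = 0") (auto simp: mult_le_cancel_left)
qed

text \<open>The resolvent preserves the sum over \<open>V\<close>, so all iterates keep mean zero
  and the contraction can be repeated.\<close>

lemma resolvent_funpow:
  assumes "(\<Sum>v\<in>V. f v) = 0" and "v \<in> V"
  shows "\<bar>(resolvent ^^ n) f v\<bar> \<le> L2_set f V * (1 / (1 + gap)) ^ n"
proof -
  have zero: "(\<Sum>v\<in>V. (resolvent ^^ n) f v) = 0" for n
    by (induction n) (simp_all add: assms sum_resolvent)
  have "L2_set ((resolvent ^^ n) f) V \<le> L2_set f V * (1 / (1 + gap)) ^ n"
  proof (induction n)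
    case (Suc n)
    have "(1 + gap) * L2_set ((resolvent ^^ Suc n) f) V \<le> L2_set f V * (1 / (1 + gap)) ^ n"
      using resolvent_contraction[OF zero[of n]] Suc by simp
    then have "L2_set ((resolvent ^^ Suc n) f) V \<le> L2_set f V * (1 / (1 + gap)) ^ n / (1 + gap)"
      using gap_pos by (subst pos_le_divide_eq) (simp_all add: mult.commute)
    then show ?case by (simp add: power_divide mult.commute)
  qed simp
  moreover have "\<bar>(resolvent ^^ n) f v\<bar> \<le> L2_set ((resolvent ^^ n) f) V"
    using member_le_L2_set[of V v "\<lambda>v. \<bar>(resolvent ^^ n) f v\<bar>"] assms(2)
    by (simp add: L2_set_def)
  ultimately show ?thesis by linarith
qed

end

section \<open>Ordered pairs under the transpositions of a connected graph\<close>

definition edge_swap :: "('i \<Rightarrow> 'a \<times> 'a) \<Rightarrow> 'i \<Rightarrow> 'a \<Rightarrow> 'a" where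
  "edge_swap e i = Transposition.transpose (fst (e i)) (snd (e i))"

text \<open>\<open>C\<close> bounds the cost of applying \<open>\<pi>\<close> to a pair, if each edge transposition costs at most \<open>1\<close>.\<close>

definition swap_cost :: "('i \<Rightarrow> 'a \<times> 'a) \<Rightarrow> ('a \<Rightarrow> 'a) \<Rightarrow> real \<Rightarrow> bool" where
  "swap_cost e \<pi> C \<longleftrightarrow> inj \<pi> \<and> (\<forall>(g :: 'a \<times> 'a \<Rightarrow> real) M.
     (\<forall>i a b. a \<noteq> b \<longrightarrow> \<bar>g (edge_swap e i a, edge_swap e i b) - g (a, b)\<bar> \<le> M) \<longrightarrow>
     (\<forall>a b. a \<noteq> b \<longrightarrow> \<bar>g (\<pi> a, \<pi> b) - g (a, b)\<bar> \<le> C * M))"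

lemma inj_transpose: "inj (Transposition.transpose a b)"
  by (metis inj_on_def transpose_involutory)

lemma swap_cost_comp:
  fixes e :: "'i \<Rightarrow> 'a \<times> 'a"
  assumes "swap_cost e \<pi> C" "swap_cost e \<sigma> D"
  shows "swap_cost e (\<pi> \<circ> \<sigma>) (C + D)"
  unfolding swap_cost_def
proof (intro conjI allI impI)
  show "inj (\<pi> \<circ> \<sigma>)" using assms by (auto simp: swap_cost_def intro: inj_compose)
next
  fix g :: "'a \<times> 'a \<Rightarrow> real" and M a b
  assume g: "\<forall>i a b. a \<noteq> b \<longrightarrow> \<bar>g (edge_swap e i a, edge_swap e i b) - g (a, b)\<bar> \<le> M"
    and "(a :: 'a) \<noteq> b"
  then have "\<bar>g (\<sigma> a, \<sigma> b) - g (a, b)\<bar> \<le> D * M" and "\<sigma> a \<noteq> \<sigma> b"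
    using assms(2) unfolding swap_cost_def by (blast, meson injD)
  moreover from g \<open>\<sigma> a \<noteq> \<sigma> b\<close> have "\<bar>g (\<pi> (\<sigma> a), \<pi> (\<sigma> b)) - g (\<sigma> a, \<sigma> b)\<bar> \<le> C * M"
    using assms(1) unfolding swap_cost_def by blast
  ultimately show "\<bar>g ((\<pi> \<circ> \<sigma>) a, (\<pi> \<circ> \<sigma>) b) - g (a, b)\<bar> \<le> (C + D) * M"
    by (simp add: distrib_right)
qed

text \<open>Induction along a path from a to c with last edge {b, c}: the transposition (a c) is the
  conjugate (a b)(b c)(a b).\<close>

lemma swap_cost_transpose:
  assumes "(a, b) \<in> (range e \<union> (range e)\<inverse>)\<^sup>*" and "a \<noteq> b"
  shows "\<exists>C. swap_cost e (Transposition.transpose a b) C"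
  using assms
proof (induction rule: rtrancl_induct)
  case (step b c)
  have edge: "swap_cost e (Transposition.transpose b c) 1"
  proof -
    obtain i where "e i = (b, c) \<or> e i = (c, b)" using step(2) by (metis UnE converseD rangeE)
    then have "edge_swap e i = Transposition.transpose b c"
      by (auto simp: edge_swap_def transpose_commute)
    then show ?thesis
      unfolding swap_cost_def using inj_transpose by (metis mult_1)
  qed
  show ?case
  proof (cases "a = b \<or> b = c")
    case True
    with edge step show ?thesis by auto
  next
    case False
    then obtain C where C: "swap_cost e (Transposition.transpose a b) C" using step by auto
    have "Transposition.transpose a c = Transposition.transpose a b \<circ> (Transposition.transpose b c \<circ> Transposition.transpose a b)"
      using False step.prems by (auto simp: fun_eq_iff Transposition.transpose_def)
    then show ?thesis using swap_cost_comp[OF C swap_cost_comp[OF edge C]] by metis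
  qed
qed simp

text \<open>Two transpositions carry any ordered pair of distinct nodes to any other, and each of
  them costs at most a common constant \<open>D\<close>.\<close>

lemma edge_swap_pairs_connected:
  fixes e :: "'i \<Rightarrow> 'a::finite \<times> 'a"
  assumes conn: "\<And>a b. (a, b) \<in> (range e \<union> (range e)\<inverse>)\<^sup>*"
  obtains d :: real where "0 < d"
    and "\<And>g M v w. (\<And>i v. v \<in> {v. fst v \<noteq> snd v} \<Longrightarrow>
        \<bar>g (map_prod (edge_swap e i) (edge_swap e i) v) - g v\<bar> \<le> M) \<Longrightarrow>
      v \<in> {v. fst v \<noteq> snd v} \<Longrightarrow> w \<in> {v. fst v \<noteq> snd v} \<Longrightarrow> \<bar>g v - g w\<bar> \<le> d * M"
proof -
  have "\<exists>C. swap_cost e (Transposition.transpose a b) C" for a b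
  proof (cases "a = b")
    case True
    then show ?thesis by (intro exI[of _ 0]) (simp add: swap_cost_def)
  qed (rule swap_cost_transpose[OF conn])
  then obtain C where C: "\<And>a b. swap_cost e (Transposition.transpose a b) (C a b)" by metis
  define D where "D = (\<Sum>a\<in>UNIV. \<Sum>b\<in>UNIV. \<bar>C a b\<bar>)"
  have CD: "C a b \<le> D" for a b
  proof -
    have "\<bar>C a b\<bar> \<le> (\<Sum>b\<in>UNIV. \<bar>C a b\<bar>)" by (rule member_le_sum) auto
    also have "\<dots> \<le> D" unfolding D_def by (rule member_le_sum) (auto intro: sum_nonneg)
    finally show ?thesis by simp
  qed
  have "0 \<le> D" unfolding D_def by (intro sum_nonneg) auto
  show thesis
  \<comment> \<open>Two transpositions cost 2 D; the summand 1 makes the constant strictly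
    positive.\<close>
  proof (rule that[of "2 * D + 1"])
    show "0 < 2 * D + 1" using \<open>0 \<le> D\<close> by simp
  next
    fix g :: "'a \<times> 'a \<Rightarrow> real" and M :: real and v w :: "'a \<times> 'a"
    assume g: "\<And>i v. v \<in> {v. fst v \<noteq> snd v} \<Longrightarrow>
        \<bar>g (map_prod (edge_swap e i) (edge_swap e i) v) - g v\<bar> \<le> M"
      and v: "v \<in> {v. fst v \<noteq> snd v}" and w: "w \<in> {v. fst v \<noteq> snd v}"
    have g': "\<forall>i a b. a \<noteq> b \<longrightarrow> \<bar>g (edge_swap e i a, edge_swap e i b) - g (a, b)\<bar> \<le> M"
      using g[of "(a, b)" for a b] by simp
    have "0 \<le> M" using abs_ge_zero g[OF v] order.trans by blast
    have step: "\<bar>g (Transposition.transpose p q a, Transposition.transpose p q b) - g (a, b)\<bar> \<le> D * M" if "a \<noteq> b" for p q a b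
    proof -
      have "\<bar>g (Transposition.transpose p q a, Transposition.transpose p q b) - g (a, b)\<bar> \<le> C p q * M"
        using C[of p q] g' that unfolding swap_cost_def by blast
      also have "\<dots> \<le> D * M" by (intro mult_right_mono CD \<open>0 \<le> M\<close>)
      finally show ?thesis .
    qed
    define a where "a = fst v" define b where "b = snd v"
    define a' where "a' = fst w" define b' where "b' = snd w"
    \<comment> \<open>The first transposition puts the first entry right and moves the second entry
      to \<open>b1\<close>. The second one exchanges \<open>b1\<close> and \<open>b'\<close>; it
      fixes \<open>a'\<close>, which differs from both.\<close>
    define b1 where "b1 = Transposition.transpose a a' b"
    have ne: "a \<noteq> b" "a' \<noteq> b'" using v w by (auto simp: a_def b_def a'_def b'_def)
    then have "a' \<noteq> b1" by (metis b1_def transpose_apply_first transpose_involutory)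
    have "\<bar>g (a', b1) - g (a, b)\<bar> \<le> D * M"
      using step[OF \<open>a \<noteq> b\<close>, of a a'] by (simp add: b1_def)
    moreover have "\<bar>g (a', b') - g (a', b1)\<bar> \<le> D * M"
      using step[OF \<open>a' \<noteq> b1\<close>, of b1 b'] ne \<open>a' \<noteq> b1\<close> by (simp add: transpose_apply_other)
    ultimately have "\<bar>g v - g w\<bar> \<le> D * M + D * M"
      by (simp add: a_def b_def a'_def b'_def)
    also have "\<dots> \<le> (2 * D + 1) * M" using \<open>0 \<le> M\<close> by (simp add: algebra_simps)
    finally show "\<bar>g v - g w\<bar> \<le> (2 * D + 1) * M" .
  qed
qed

section \<open>The edges of the cyclic network\<close>

definition cyc_edge :: "('k::nontriv mod_ring \<times> 'n \<times> 'n) \<Rightarrow> ('k, 'n) node \<times> ('k, 'n) node" where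
  "cyc_edge = (\<lambda>(v, n, k). ((v, n), (v + 1, k)))"

lemma cyc_edge_connected:
  fixes a b :: "('k::nontriv, 'n) node"
  shows "(a, b) \<in> (range cyc_edge \<union> (range cyc_edge)\<inverse>)\<^sup>*"
proof -
  obtain v n where a: "a = (v, n)" by force
  obtain w k where b: "b = (w, k)" by force
  have edge: "((v, n), (v + 1, k)) \<in> range cyc_edge \<union> (range cyc_edge)\<inverse>" for v :: "'k mod_ring" and n k :: 'n
    by (intro UnI1 range_eqI[of _ _ "(v, n, k)"]) (simp add: cyc_edge_def)
  have reach: "((v, n), (v + of_nat (Suc i), k)) \<in> (range cyc_edge \<union> (range cyc_edge)\<inverse>)\<^sup>*" for i k
  proof (induction i arbitrary: k)
    case 0
    show ?case using r_into_rtrancl[OF edge[of v n k]] by simp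
  next
    case (Suc i)
    have "v + of_nat (Suc (Suc i)) = v + of_nat (Suc i) + 1" by simp
    then show ?case
      using rtrancl_into_rtrancl[OF Suc[of k] edge[of "v + of_nat (Suc i)" k k]] by metis
  qed
  \<comment> \<open>Subtracting 1 guarantees at least one step, which is needed to change the copy:
    from a vertex to itself the path goes once around the cycle.\<close>
  obtain i where "w - v - 1 = of_nat i"
    by (metis of_int_mod_ring_to_int_mod_ring of_int_of_int_mod_ring of_int_of_nat_eq
        nat_0_le atLeastLessThan_iff range_to_int_mod_ring rangeI)
  then have "w = v + of_nat (Suc i)" by (simp add: algebra_simps)
  then show ?thesis using reach[of i k] by (simp add: a b)
qed

section \<open>The network as a chain with finitely many moves\<close>

type_synonym ('k, 'n) move =
  "(('k, 'n) node \<times> 'k mod_ring) + (('k, 'n) node \<times> 'n) + ('k mod_ring \<times> 'n \<times> 'n)"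

fun do_move :: "('k, 'n) move \<Rightarrow> ('k::nontriv, 'n::finite) config \<Rightarrow> ('k, 'n) config" where
  "do_move (Inl (a, w)) x = arrive a w x"
| "do_move (Inr (Inl (a, k))) x = serve a k x"
| "do_move (Inr (Inr e)) x = swap (fst (cyc_edge e)) (snd (cyc_edge e)) x"

text \<open>A service at an empty queue is a move of rate 0, so the unspecified value
  \<open>hd []\<close> in \<open>serve\<close> carries no weight.\<close>

fun move_rate ::
  "real \<Rightarrow> real \<Rightarrow> 'k mod_ring pmf \<Rightarrow> ('k, 'n) move \<Rightarrow> ('k::nontriv, 'n::finite) config \<Rightarrow> real" where
  "move_rate lam beta p (Inl (a, w)) x = lam * pmf p (w - fst a)"
| "move_rate lam beta p (Inr (Inl (a, k))) x = 1 / real CARD('n) * of_bool (x a \<noteq> [])"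
| "move_rate lam beta p (Inr (Inr e)) x = beta / real CARD('n)"

text \<open>The relabelling of nodes that follows the servers; only a swap displaces them.\<close>

fun move_perm :: "('k, 'n) move \<Rightarrow> ('k::nontriv, 'n) node \<Rightarrow> ('k, 'n) node" where
  "move_perm (Inl _) = id"
| "move_perm (Inr (Inl _)) = id"
| "move_perm (Inr (Inr e)) = edge_swap cyc_edge e"

lemma sum_moves:
  fixes g :: "('k::nontriv, 'n::finite) move \<Rightarrow> real"
  shows "(\<Sum>i\<in>UNIV. g i) = (\<Sum>a\<in>UNIV. \<Sum>w\<in>UNIV. g (Inl (a, w))) +
    (\<Sum>a\<in>UNIV. \<Sum>k\<in>UNIV. g (Inr (Inl (a, k)))) + (\<Sum>e\<in>UNIV. g (Inr (Inr e)))"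
  by (simp add: sum.Plus sum.cartesian_product flip: UNIV_Plus_UNIV UNIV_Times_UNIV)

lemma sum_UNIV_prod:
  fixes g :: "'a::finite \<times> 'b::finite \<Rightarrow> 'c::comm_monoid_add"
  shows "(\<Sum>a\<in>UNIV. g a) = (\<Sum>v\<in>UNIV. \<Sum>n\<in>UNIV. g (v, n))"
  by (simp add: sum.cartesian_product flip: UNIV_Times_UNIV)

lemma network_rate_eq_moves:
  "network_rate lam beta p x y = (\<Sum>i\<in>UNIV. move_rate lam beta p i x * of_bool (y = do_move i x))"
  unfolding sum_moves network_rate_def sum_UNIV_prod
  by (simp add: cyc_edge_def of_bool_conj mult_ac)

lemma bij_edge_swap: "bij (edge_swap e i)"
  unfolding edge_swap_def by (rule bij_transpose)

lemma edge_swap_involutory: "edge_swap e i (edge_swap e i a) = a"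
  unfolding edge_swap_def by (rule transpose_involutory)

lemma swap_eq_edge_swap:
  "swap (fst (cyc_edge e)) (snd (cyc_edge e)) x (edge_swap cyc_edge e b) = x b"
  by (auto simp: swap_def edge_swap_def Transposition.transpose_def)

section \<open>The corrected queue length\<close>

text \<open>\<open>\<psi> (Suc j) D (a, b)\<close> is the expected effect (minus its mean) on queue \<open>a\<close> of the customer with destination \<open>D\<close> that has
  \<open>j\<close> customers in front of it in queue \<open>b\<close>.\<close>

definition correction :: "(nat \<Rightarrow> 'd \<Rightarrow> 'v \<Rightarrow> real) \<Rightarrow> 'd list \<Rightarrow> 'v \<Rightarrow> real" where
  "correction \<psi> l v = (\<Sum>j<length l. \<psi> (Suc j) (l ! j) v)"

text \<open>The term b = a is left out: the walk on pairs never leaves the diagonal, where no decay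
  of \<open>\<psi>\<close> is available, and the loss through services at \<open>a\<close> is
  already seen by the length.\<close>

definition corrected_length ::
  "(nat \<Rightarrow> 'd \<Rightarrow> 'a \<times> 'a \<Rightarrow> real) \<Rightarrow> ('a::finite \<Rightarrow> 'd list) \<Rightarrow> 'a \<Rightarrow> real" where
  "corrected_length \<psi> x a = real (length (x a)) + (\<Sum>b\<in>-{a}. correction \<psi> (x b) (a, b))"

lemma correction_snoc: "correction \<psi> (l @ [D]) v = correction \<psi> l v + \<psi> (Suc (length l)) D v"
  by (simp add: correction_def nth_append)

text \<open>After the head has gone, every remaining customer is one place further forward, so
  \<open>\<psi> (Suc j)\<close> becomes \<open>\<psi> j\<close>. The sum also contains j = 0, the
  former head, which is subtracted.\<close>

lemma correction_tl:
  assumes "l \<noteq> []"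
  shows "correction \<psi> (tl l) v = (\<Sum>j<length l. \<psi> j (l ! j) v) - \<psi> 0 (hd l) v"
proof -
  obtain D m where l: "l = D # m" using assms by (cases l) auto
  show ?thesis unfolding l by (simp add: correction_def sum.lessThan_Suc_shift del: sum.lessThan_Suc)
qed

lemma corrected_length_upd:
  "corrected_length \<psi> (x(e := l)) a - corrected_length \<psi> x a =
    (if a = e then real (length l) - real (length (x e))
     else correction \<psi> l (a, e) - correction \<psi> (x e) (a, e))"
proof (cases "a = e")
  case True
  have "(\<Sum>b\<in>-{e}. correction \<psi> ((x(e := l)) b) (e, b)) = (\<Sum>b\<in>-{e}. correction \<psi> (x b) (e, b))"
    by (rule sum.cong) auto
  with True show ?thesis by (simp add: corrected_length_def)
next
  case False
  then have e: "e \<in> -{a}" by simp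
  have "(\<Sum>b\<in>-{a}-{e}. correction \<psi> ((x(e := l)) b) (a, b)) = (\<Sum>b\<in>-{a}-{e}. correction \<psi> (x b) (a, b))"
    by (rule sum.cong) auto
  then show ?thesis
    using False unfolding corrected_length_def
    by (simp add: sum.remove[OF _ e])
qed

lemma corrected_length_arrive:
  "corrected_length \<psi> (arrive e w x) a - corrected_length \<psi> x a =
    (if a = e then 1 else \<psi> (Suc (length (x e))) w (a, e))"
  unfolding arrive_def corrected_length_upd by (simp add: correction_snoc)

text \<open>Seen from the servers, a swap leaves all queues as they are and only moves the pairs of
  positions at which \<open>\<psi>\<close> is evaluated.\<close>

lemma corrected_length_swap:
  fixes x :: "('k::nontriv, 'n::finite) config"
  shows "corrected_length \<psi> (swap (fst (cyc_edge e)) (snd (cyc_edge e)) x) (edge_swap cyc_edge e a) =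
    real (length (x a)) +
    (\<Sum>b\<in>-{a}. correction \<psi> (x b) (edge_swap cyc_edge e a, edge_swap cyc_edge e b))"
proof -
  let ?\<tau> = "edge_swap cyc_edge e :: ('k, 'n) node \<Rightarrow> _" and ?y = "swap (fst (cyc_edge e)) (snd (cyc_edge e)) x"
  have inj: "?\<tau> b = ?\<tau> a \<longleftrightarrow> b = a" for a b by (metis edge_swap_involutory)
  have y: "?y b = x (?\<tau> b)" for b using swap_eq_edge_swap[of e x "?\<tau> b"] by (simp add: edge_swap_involutory)
  have "(\<Sum>b\<in>-{?\<tau> a}. correction \<psi> (?y b) (?\<tau> a, b)) = (\<Sum>b\<in>-{a}. correction \<psi> (x b) (?\<tau> a, ?\<tau> b))"
    by (rule sum.reindex_bij_witness[of _ ?\<tau> ?\<tau>]) (simp_all add: y edge_swap_involutory inj, metis edge_swap_involutory)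
  then show ?thesis by (simp add: corrected_length_def swap_eq_edge_swap)
qed

section \<open>Drift of the corrected queue length\<close>

abbreviation pair_swap :: "'k::nontriv mod_ring \<times> 'n \<times> 'n \<Rightarrow> ('k, 'n) node \<times> ('k, 'n) node \<Rightarrow> ('k, 'n) node \<times> ('k, 'n) node" where
  "pair_swap e \<equiv> map_prod (edge_swap cyc_edge e) (edge_swap cyc_edge e)"

text \<open>The rate at which a customer with destination \<open>D\<close> at the head of queue \<open>b\<close> moves to queue \<open>a\<close>.\<close>

definition route_rate :: "'k mod_ring \<Rightarrow> ('k::nontriv, 'n::finite) node \<times> ('k, 'n) node \<Rightarrow> real" where
  "route_rate D = (\<lambda>(a, b). if D \<in> {fst b - 1, fst b, fst b + 1} then 0
     else 1 / real CARD('n) * of_bool (fst a = next_vertex (fst b) D))"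

text \<open>\<open>c\<close> is the mean rate at which a head customer is routed from a given queue
  to a given other one. \<open>supercritical\<close> says that arrivals together with this mean flow
  from all other queues exceed the service rate 1.\<close>

locale network_corrector =
  fixes lam beta :: real and p :: "'k::nontriv mod_ring pmf"
    and \<psi> :: "nat \<Rightarrow> 'k mod_ring \<Rightarrow> ('k, 'n::finite) node \<times> ('k, 'n) node \<Rightarrow> real"
    and B \<rho> c :: real
  assumes lam: "0 < lam" and beta: "0 < beta" and B: "0 \<le> B" and \<rho>: "0 < \<rho>" "\<rho> < 1"
    and \<psi>_bound: "\<And>a b j D. a \<noteq> b \<Longrightarrow> \<bar>\<psi> j D (a, b)\<bar> \<le> B * \<rho> ^ j"
    and \<psi>_Suc: "\<And>j D v. \<psi> (Suc j) D v -
      walk_gen (beta / real CARD('n)) pair_swap (\<psi> (Suc j) D) v = \<psi> j D v"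
    and \<psi>_0: "\<And>a b D. a \<noteq> b \<Longrightarrow> \<psi> 0 D (a, b) = route_rate D (a, b) - c"
    and supercritical: "1 < lam + (real CARD(('k, 'n) node) - 1) * c"
begin

abbreviation "H \<equiv> corrected_length \<psi>"

lemma correction_bound:
  assumes "a \<noteq> b"
  shows "\<bar>correction \<psi> l (a, b)\<bar> \<le> B / (1 - \<rho>)"
proof -
  have "\<bar>correction \<psi> l (a, b)\<bar> \<le> (\<Sum>j<length l. \<bar>\<psi> (Suc j) (l ! j) (a, b)\<bar>)"
    unfolding correction_def by (rule sum_abs)
  also have "\<dots> \<le> (\<Sum>j<length l. B * \<rho> ^ j)"
  proof (rule sum_mono)
    fix j
    have "\<rho> ^ Suc j \<le> \<rho> ^ j" using \<rho> by (intro power_decreasing) auto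
    then show "\<bar>\<psi> (Suc j) (l ! j) (a, b)\<bar> \<le> B * \<rho> ^ j"
      using \<psi>_bound[OF assms, of "Suc j" "l ! j"] B by (meson mult_left_mono order.trans)
  qed
  also have "\<dots> = B * ((1 - \<rho> ^ length l) / (1 - \<rho>))"
    using \<rho> by (simp add: sum_gp_strict flip: sum_distrib_left)
  also have "\<dots> \<le> B * (1 / (1 - \<rho>))"
    using B \<rho> by (intro mult_left_mono divide_right_mono) auto
  finally show ?thesis by simp
qed

definition corr_max :: real where
  "corr_max = real CARD(('k, 'n) node) * (B / (1 - \<rho>))"

lemma sum_correction_bound:
  assumes "\<And>b. b \<in> -{a} \<Longrightarrow> h b \<noteq> g b"
  shows "\<bar>\<Sum>b\<in>-{a :: ('k, 'n) node}. correction \<psi> (x b) (h b, g b)\<bar> \<le> corr_max"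
proof -
  have "0 \<le> B / (1 - \<rho>)" using B \<rho> by simp
  have "\<bar>\<Sum>b\<in>-{a}. correction \<psi> (x b) (h b, g b)\<bar> \<le> (\<Sum>b\<in>-{a}. \<bar>correction \<psi> (x b) (h b, g b)\<bar>)"
    by (rule sum_abs)
  also have "\<dots> \<le> (\<Sum>b\<in>-{a}. B / (1 - \<rho>))"
    by (intro sum_mono correction_bound assms)
  also have "\<dots> \<le> (\<Sum>b\<in>(UNIV :: ('k, 'n) node set). B / (1 - \<rho>))"
    by (rule sum_mono2) (use \<open>0 \<le> B / (1 - \<rho>)\<close> in auto)
  also have "\<dots> = corr_max" by (simp add: corr_max_def)
  finally show ?thesis .
qed

lemma H_bound: "\<bar>H x a - real (length (x a))\<bar> \<le> corr_max"
  unfolding corrected_length_def using sum_correction_bound[of a "\<lambda>_. a" "\<lambda>b. b" x] by simp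

text \<open>The newcomer stands behind at least \<open>L\<close> customers, so elsewhere its
  correction is at most \<open>B * \<rho> ^ L\<close> in absolute value.\<close>

lemma arrive_increment:
  assumes "L \<le> length (x e)"
  shows "of_bool (a = e) - B * \<rho> ^ L \<le> H (arrive e w x) a - H x a"
proof (cases "a = e")
  case True
  then show ?thesis using B \<rho> by (simp add: corrected_length_arrive)
next
  case False
  have "\<rho> ^ Suc (length (x e)) \<le> \<rho> ^ L" using \<rho> assms by (intro power_decreasing) auto
  then have "\<bar>\<psi> (Suc (length (x e))) w (a, e)\<bar> \<le> B * \<rho> ^ L"
    using \<psi>_bound[OF False, of "Suc (length (x e))" w] B by (meson mult_left_mono order.trans)
  with False show ?thesis by (simp add: corrected_length_arrive)
qed

lemma arrivals_drift:
  assumes "\<And>b. L \<le> length (x b)"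
  shows "lam - lam * real CARD(('k, 'n) node) * (B * \<rho> ^ L) \<le>
    (\<Sum>e\<in>UNIV. \<Sum>w\<in>UNIV. lam * pmf p (w - fst e) * (H (arrive e w x) a - H x a))"
proof -
  have pmf_sum: "(\<Sum>w\<in>UNIV. pmf p (w - v)) = 1" for v
  proof -
    have "(\<Sum>w\<in>UNIV. pmf p (w - v)) = (\<Sum>w\<in>UNIV. pmf p w)"
      by (rule sum.reindex_bij_witness[of _ "\<lambda>w. w + v" "\<lambda>w. w - v"]) auto
    then show ?thesis by (simp add: sum_pmf_eq_1)
  qed
  have "lam - lam * real CARD(('k, 'n) node) * (B * \<rho> ^ L) =
      (\<Sum>e\<in>UNIV. lam * (of_bool (a = e) - B * \<rho> ^ L))"
    by (simp add: sum_subtractf right_diff_distrib flip: sum_distrib_left)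
  also have "\<dots> = (\<Sum>e\<in>UNIV. \<Sum>w\<in>UNIV. lam * pmf p (w - fst e) * (of_bool (a = e) - B * \<rho> ^ L))"
    by (simp add: pmf_sum flip: sum_distrib_left sum_distrib_right)
  also have "\<dots> \<le> (\<Sum>e\<in>UNIV. \<Sum>w\<in>UNIV. lam * pmf p (w - fst e) * (H (arrive e w x) a - H x a))"
    using lam by (intro sum_mono mult_left_mono arrive_increment assms) auto
  finally show ?thesis .
qed

text \<open>A service removes the head and possibly lets it arrive at the next node. The hypothesis
  has \<open>Suc L\<close> so that all queues still have length \<open>L\<close> between these two
  steps.\<close>

lemma serve_increment:
  assumes "\<And>b. Suc L \<le> length (x b)"
  shows "(if a = e then - 1 else correction \<psi> (tl (x e)) (a, e) - correction \<psi> (x e) (a, e)) +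
      (of_bool (hd (x e) \<notin> {fst e - 1, fst e, fst e + 1} \<and> a = (next_vertex (fst e) (hd (x e)), k)) - B * \<rho> ^ L)
    \<le> H (serve e k x) a - H x a"
proof -
  define x' where "x' = x(e := tl (x e))"
  have pop: "H x' a - H x a =
      (if a = e then - 1 else correction \<psi> (tl (x e)) (a, e) - correction \<psi> (x e) (a, e))"
    using assms[of e] unfolding x'_def corrected_length_upd by (auto simp: of_nat_diff)
  have len: "L \<le> length (x' b)" for b
    using assms[of b] by (auto simp: x'_def)
  have "0 \<le> B * \<rho> ^ L" using B \<rho> by simp
  show ?thesis
  proof (cases "hd (x e) \<in> {fst e - 1, fst e, fst e + 1}")
    case True
    then have "serve e k x = x'" by (auto simp: serve_def Let_def x'_def)
    with True pop \<open>0 \<le> B * \<rho> ^ L\<close> show ?thesis by auto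
  next
    case False
    define d where "d = (next_vertex (fst e) (hd (x e)), k)"
    have "serve e k x = arrive d (hd (x e)) x'"
      using False by (auto simp: serve_def Let_def x'_def d_def)
    moreover have "of_bool (a = d) - B * \<rho> ^ L \<le> H (arrive d (hd (x e)) x') a - H x' a"
      by (rule arrive_increment[OF len])
    ultimately show ?thesis
      unfolding pop[symmetric] d_def[symmetric] using False by simp
  qed
qed

lemma services_drift:
  assumes "\<And>b. Suc L \<le> length (x b)"
  shows "- 1 + (\<Sum>e\<in>-{a}. correction \<psi> (tl (x e)) (a, e) - correction \<psi> (x e) (a, e) + route_rate (hd (x e)) (a, e))
      - real CARD(('k, 'n) node) * (B * \<rho> ^ L) \<le>
    (\<Sum>e\<in>UNIV. \<Sum>k\<in>UNIV. 1 / real CARD('n) * (H (serve e k x) a - H x a))"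
proof -
  define pop where "pop = (\<lambda>e. if a = e then - 1 else correction \<psi> (tl (x e)) (a, e) - correction \<psi> (x e) (a, e))"
  define gain where "gain = (\<lambda>e k. of_bool (hd (x e) \<notin> {fst e - 1, fst e, fst e + 1} \<and> a = (next_vertex (fst e) (hd (x e)), k)) :: real)"
  have gain: "(\<Sum>k\<in>UNIV. 1 / real CARD('n) * gain e k) = route_rate (hd (x e)) (a, e)" for e
  proof -
    have "(\<Sum>k\<in>UNIV. of_bool (a = (v, k)) :: real) = of_bool (fst a = v)" for v
      by (cases a) (simp add: of_bool_conj flip: sum_distrib_left)
    then show ?thesis
      by (simp add: gain_def route_rate_def of_bool_conj flip: sum_distrib_left sum_divide_distrib)
  qed
  \<comment> \<open>Adding the nonnegative term \<open>route_rate (hd (x a)) (a, a)\<close>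
    completes the sum to all nodes.\<close>
  have "- 1 + (\<Sum>e\<in>-{a}. correction \<psi> (tl (x e)) (a, e) - correction \<psi> (x e) (a, e) + route_rate (hd (x e)) (a, e)) \<le>
      - 1 + (\<Sum>e\<in>-{a}. pop e + route_rate (hd (x e)) (a, e)) + route_rate (hd (x a)) (a, a)"
    by (auto simp: pop_def route_rate_def intro!: sum_mono)
  also have "\<dots> = (\<Sum>e\<in>UNIV. pop e + route_rate (hd (x e)) (a, e))"
    by (simp add: pop_def sum.remove[of UNIV a] Compl_eq_Diff_UNIV)
  finally have "- 1 + (\<Sum>e\<in>-{a}. correction \<psi> (tl (x e)) (a, e) - correction \<psi> (x e) (a, e) + route_rate (hd (x e)) (a, e))
      - real CARD(('k, 'n) node) * (B * \<rho> ^ L) \<le>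
      (\<Sum>e\<in>UNIV. pop e + route_rate (hd (x e)) (a, e) - B * \<rho> ^ L)"
    by (simp add: sum_subtractf)
  also have "\<dots> = (\<Sum>e\<in>UNIV. \<Sum>k\<in>UNIV. 1 / real CARD('n) * (pop e + (gain e k - B * \<rho> ^ L)))"
    unfolding gain[symmetric]
    by (simp add: distrib_left right_diff_distrib sum.distrib sum_subtractf)
  also have "\<dots> \<le> (\<Sum>e\<in>UNIV. \<Sum>k\<in>UNIV. 1 / real CARD('n) * (H (serve e k x) a - H x a))"
    unfolding pop_def gain_def by (intro sum_mono mult_left_mono serve_increment assms) auto
  finally show ?thesis .
qed

text \<open>The generator turns \<open>\<psi> (Suc j)\<close> into \<open>\<psi> (Suc j)\<close> -
  \<open>\<psi> j\<close>. Summed over a queue, this is minus the change of the correction when its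
  head is removed, minus the source term \<open>\<psi> 0\<close> of the head.\<close>

lemma swaps_drift:
  assumes "\<And>b. x b \<noteq> []"
  shows "(\<Sum>e\<in>UNIV. beta / real CARD('n) *
      (H (swap (fst (cyc_edge e)) (snd (cyc_edge e)) x) (edge_swap cyc_edge e a) - H x a)) =
    (\<Sum>b\<in>-{a}. correction \<psi> (x b) (a, b) - correction \<psi> (tl (x b)) (a, b) - \<psi> 0 (hd (x b)) (a, b))"
proof -
  have gen: "walk_gen (beta / real CARD('n)) pair_swap (correction \<psi> l) v =
      correction \<psi> l v - correction \<psi> (tl l) v - \<psi> 0 (hd l) v" if "l \<noteq> []" for l v
  proof -
    have "walk_gen (beta / real CARD('n)) pair_swap (correction \<psi> l) v =
        (\<Sum>j<length l. walk_gen (beta / real CARD('n)) pair_swap (\<psi> (Suc j) (l ! j)) v)"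
      unfolding walk_gen_def correction_def sum_subtractf[symmetric]
      by (subst sum.swap) (simp only: sum_distrib_left)
    also have "\<dots> = (\<Sum>j<length l. \<psi> (Suc j) (l ! j) v - \<psi> j (l ! j) v)"
      by (intro sum.cong refl) (use \<psi>_Suc in \<open>simp add: algebra_simps\<close>)
    finally show ?thesis
      unfolding correction_tl[OF that] by (simp add: sum_subtractf correction_def)
  qed
  have "(\<Sum>e\<in>UNIV. beta / real CARD('n) *
      (H (swap (fst (cyc_edge e)) (snd (cyc_edge e)) x) (edge_swap cyc_edge e a) - H x a)) =
    (\<Sum>e\<in>UNIV. \<Sum>b\<in>-{a}. beta / real CARD('n) * (correction \<psi> (x b) (pair_swap e (a, b)) - correction \<psi> (x b) (a, b)))"
    unfolding corrected_length_swap unfolding corrected_length_def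
    by (simp only: sum_subtractf sum_distrib_left[symmetric] map_prod_simp add_diff_cancel_left)
  also have "\<dots> = (\<Sum>b\<in>-{a}. walk_gen (beta / real CARD('n)) pair_swap (correction \<psi> (x b)) (a, b))"
    unfolding walk_gen_def by (subst sum.swap) (simp only: sum_distrib_left)
  finally show ?thesis by (simp add: gen assms)
qed

text \<open>The swaps cancel the change of the corrections caused by removing the heads, and the
  source term \<open>\<psi> 0\<close> replaces each actual routing rate by its mean
  \<open>c\<close>. What remains is independent of the destinations, up to the corrections of newly
  joined customers.\<close>

lemma total_drift:
  assumes "\<And>b. Suc L \<le> length (x b)"
  shows "lam + (real CARD(('k, 'n) node) - 1) * c - 1 - (lam + 1) * real CARD(('k, 'n) node) * (B * \<rho> ^ L) \<le>
    (\<Sum>i\<in>UNIV. move_rate lam beta p i x * (H (do_move i x) (move_perm i a) - H x a))"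
proof -
  have ne: "x b \<noteq> []" and L: "L \<le> length (x b)" for b using assms[of b] by auto
  have "(\<Sum>e\<in>-{a}. correction \<psi> (tl (x e)) (a, e) - correction \<psi> (x e) (a, e) + route_rate (hd (x e)) (a, e)) +
      (\<Sum>b\<in>-{a}. correction \<psi> (x b) (a, b) - correction \<psi> (tl (x b)) (a, b) - \<psi> 0 (hd (x b)) (a, b)) =
      (\<Sum>b\<in>-{a}. c)"
    unfolding sum.distrib[symmetric] by (intro sum.cong) (auto simp: \<psi>_0)
  also have "\<dots> = (real CARD(('k, 'n) node) - 1) * c"
    by (simp add: Compl_eq_Diff_UNIV card_Diff_subset of_nat_diff Suc_leI)
  finally show ?thesis
    using arrivals_drift[where x=x and a=a, OF L] services_drift[where x=x and a=a, OF assms]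
      swaps_drift[where x=x and a=a, OF ne]
    unfolding sum_moves by (simp add: ne algebra_simps)
qed

section \<open>Bounds on rates and jumps, and reachability of long queues\<close>

lemma move_rate_nonneg: "0 \<le> move_rate lam beta p i x"
  using lam beta by (cases "(lam, beta, p, i, x)" rule: move_rate.cases) auto

lemma move_rate_le:
  fixes x :: "('k, 'n) config"
  shows "move_rate lam beta p i x \<le> lam + 1 + beta"
proof (cases i rule: move_perm.cases)
  case (1 aw)
  obtain a w where "aw = (a, w)" by (cases aw)
  moreover have "lam * pmf p (w - fst a) \<le> lam * 1"
    using lam by (intro mult_left_mono pmf_le_1) simp
  ultimately show ?thesis using 1 beta by simp
next
  case (2 ak)
  obtain a k where "ak = (a, k)" by (cases ak)
  then have "move_rate lam beta p i x \<le> 1" using 2 by (simp add: Suc_leI)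
  then show ?thesis using lam beta by linarith
next
  case (3 e)
  have "beta / real CARD('n) \<le> beta / 1"
    using beta by (intro divide_left_mono) (auto simp: Suc_leI)
  with 3 lam show ?thesis by simp
qed

lemma length_move: "\<bar>real (length (do_move i x (move_perm i a))) - real (length (x a))\<bar> \<le> 2"
proof (cases "(i, x)" rule: do_move.cases)
  case (1 e w x)
  then show ?thesis by (auto simp: arrive_def)
next
  case (2 e k x)
  then show ?thesis by (auto simp: serve_def arrive_def Let_def)
next
  case (3 e x)
  then show ?thesis by (simp add: swap_eq_edge_swap)
qed

lemma arrive_step:
  obtains w where "(x, arrive a w x) \<in> move_rel (move_rate lam beta p) do_move"
proof -
  obtain z where "z \<in> set_pmf p" using set_pmf_not_empty[of p] by blast
  then have "0 < move_rate lam beta p (Inl (a, z + fst a)) x"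
    using lam by (simp add: pmf_positive)
  moreover have "arrive a (z + fst a) x \<noteq> x"
    by (simp add: arrive_def fun_upd_idem_iff)
  ultimately have "(x, arrive a (z + fst a) x) \<in> move_rel (move_rate lam beta p) do_move"
    unfolding move_rel_def by (intro CollectI case_prodI exI[of _ "Inl (a, z + fst a)"]) simp
  then show thesis by (rule that)
qed

text \<open>Arrivals alone suffice: each arrival at a short queue lowers the total number of missing
  customers.\<close>

lemma reach_long_queues:
  "\<exists>y. (x, y) \<in> (move_rel (move_rate lam beta p) do_move)\<^sup>* \<and> (\<forall>a. n \<le> length (y a))"
proof (induction "\<Sum>a\<in>UNIV. n - length (x a)" arbitrary: x rule: less_induct)
  case less
  show ?case
  proof (cases "\<forall>a. n \<le> length (x a)")
    case False
    then obtain a where a: "length (x a) < n" by (auto simp: not_le)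
    obtain w where step: "(x, arrive a w x) \<in> move_rel (move_rate lam beta p) do_move"
      by (rule arrive_step)
    have "(\<Sum>b\<in>UNIV. n - length (arrive a w x b)) < (\<Sum>b\<in>UNIV. n - length (x b))"
    proof (rule sum_strict_mono_ex1)
      show "\<exists>b\<in>UNIV. n - length (arrive a w x b) < n - length (x b)"
        by (rule bexI[of _ a]) (use a in \<open>simp_all add: arrive_def\<close>)
    qed (auto simp: arrive_def)
    from less[OF this] show ?thesis
      using step by (meson converse_rtrancl_into_rtrancl)
  qed blast
qed

lemma transient_network:
  fixes P :: "('k, 'n) config \<Rightarrow> 'w measure"
  assumes "markov_chain_with_rates (network_rate lam beta p) P X"
  shows "transient P X"
proof -
  define m where "m = lam + (real CARD(('k, 'n) node) - 1) * c - 1"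
  have "0 < m" using supercritical by (simp add: m_def)
  define A where "A = (lam + 1) * real CARD(('k, 'n) node) * B"
  have "0 \<le> A" using lam B by (simp add: A_def)
  \<comment> \<open>\<open>L\<close> is so large that the corrections of newly joined customers use
    up at most half of the margin \<open>m\<close>; A + 1 avoids division by zero.\<close>
  obtain L where L: "\<rho> ^ L < m / (2 * (A + 1))"
    using real_arch_pow_inv[of "m / (2 * (A + 1))" \<rho>] \<open>0 < m\<close> \<open>0 \<le> A\<close> \<rho> by auto
  have err: "A * \<rho> ^ L \<le> m / 2"
  proof -
    have "A * \<rho> ^ L \<le> (A + 1) * (m / (2 * (A + 1)))"
      using L \<open>0 \<le> A\<close> \<rho> by (intro mult_mono) auto
    also have "\<dots> = m / 2" using \<open>0 \<le> A\<close> by (simp add: field_simps)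
    finally show ?thesis .
  qed
  show ?thesis
  \<comment> \<open>A corrected length of at least \<open>Suc L + corr_max\<close> forces a true
    length of at least \<open>Suc L\<close>. For \<open>J\<close>, a move changes the followed
    length by at most 2, and the corrections before and after are each at most
    \<open>corr_max\<close>.\<close>
  proof (rule transient_if_drift[OF assms network_rate_eq_moves move_rate_nonneg,
        where H=H and \<pi>=move_perm and \<delta>="m / 2" and hmin="real (Suc L) + corr_max"
          and J="2 * corr_max + 2" and R="(\<Sum>i\<in>(UNIV :: ('k, 'n) move set). lam + 1 + beta)"])
    show "(\<Sum>i\<in>UNIV. move_rate lam beta p i x) \<le> (\<Sum>i\<in>(UNIV :: ('k, 'n) move set). lam + 1 + beta)"
      for x :: "('k, 'n) config"
      by (intro sum_mono move_rate_le)
    show "\<exists>i. 0 < move_rate lam beta p i x \<and> do_move i x \<noteq> x" for x :: "('k, 'n) config"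
      using arrive_step[of x undefined] unfolding move_rel_def by blast
    show "bij (move_perm i)" for i :: "('k, 'n) move"
      by (cases i rule: move_perm.cases) (auto simp: bij_edge_swap)
    show "\<bar>H (do_move i x) (move_perm i a) - H x a\<bar> \<le> 2 * corr_max + 2" for i x a
      using H_bound[of "do_move i x" "move_perm i a"] H_bound[of x a] length_move[of i x a] by linarith
    show "0 < m / 2" using \<open>0 < m\<close> by simp
    show "m / 2 \<le> (\<Sum>i\<in>UNIV. move_rate lam beta p i x * (H (do_move i x) (move_perm i a) - H x a))"
      if "\<And>b. real (Suc L) + corr_max \<le> H x b" for x a
    proof -
      have "Suc L \<le> length (x b)" for b
        using that[of b] H_bound[of x b] by linarith
      from total_drift[where x=x and a=a, OF this] err show ?thesis
        by (simp add: m_def A_def mult_ac)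
    qed
    show "\<exists>y. (x, y) \<in> (move_rel (move_rate lam beta p) do_move)\<^sup>* \<and> (\<forall>a. h \<le> H y a)" for h x
    proof -
      obtain n where n: "h + corr_max \<le> real n" using real_arch_simple by blast
      obtain y where y: "(x, y) \<in> (move_rel (move_rate lam beta p) do_move)\<^sup>*" "\<And>a. n \<le> length (y a)"
        using reach_long_queues by blast
      have "h \<le> H y a" for a
        using n H_bound[of y a] y(2)[of a] by linarith
      with y(1) show ?thesis by blast
    qed
  qed
qed

end

section \<open>Existence of the correction\<close>

lemma sum_off_diagonal:
  fixes f :: "'a::finite \<times> 'a \<Rightarrow> real"
  shows "(\<Sum>v | fst v \<noteq> snd v. f v) = (\<Sum>b\<in>UNIV. \<Sum>a\<in>-{b}. f (a, b))"
proof -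
  have "(\<Sum>b\<in>UNIV. \<Sum>a\<in>-{b}. f (a, b)) = (\<Sum>(b, a)\<in>Sigma UNIV (\<lambda>b. -{b}). f (a, b))"
    by (rule sum.Sigma) auto
  also have "\<dots> = (\<Sum>v | fst v \<noteq> snd v. f v)"
    by (rule sum.reindex_bij_witness[of _ prod.swap prod.swap]) auto
  finally show ?thesis by simp
qed

text \<open>A server at a vertex within distance 1 of \<open>D\<close> routes nobody with
  destination \<open>D\<close>, any other server routes at total rate 1, always to a different
  vertex. There are three excluded vertices with \<open>CARD('n)\<close> servers each.\<close>

lemma sum_route_rate:
  fixes D :: "'k::nontriv mod_ring"
  assumes "3 \<le> CARD('k)"
  shows "(\<Sum>v | fst v \<noteq> snd v. route_rate D (v :: ('k, 'n::finite) node \<times> ('k, 'n) node)) =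
    real CARD('n) * (real CARD('k) - 3)"
proof -
  \<comment> \<open>Makes D - 1 and D + 1 distinct, so that exactly three vertices are
    excluded.\<close>
  have two: "(1 :: 'k mod_ring) + 1 \<noteq> 0"
  proof
    assume "(1 :: 'k mod_ring) + 1 = 0"
    then have "of_int_mod_ring 2 = (0 :: 'k mod_ring)"
      by (metis of_int_of_int_mod_ring of_int_numeral one_add_one)
    then have "to_int_mod_ring (of_int_mod_ring 2 :: 'k mod_ring) = 0" by simp
    then show False using assms by simp
  qed
  have next_ne: "next_vertex v D \<noteq> v" for v :: "'k mod_ring"
    by (simp add: next_vertex_def)
  have inner: "(\<Sum>a\<in>-{b}. route_rate D (a, b)) = of_bool (D \<notin> {fst b - 1, fst b, fst b + 1})"
    for b :: "('k, 'n) node"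
  proof -
    have "(\<Sum>a\<in>-{b}. route_rate D (a, b)) = (\<Sum>a\<in>UNIV. route_rate D (a, b))"
      by (rule sum.mono_neutral_left) (use next_ne[of "fst b"] in \<open>auto simp: route_rate_def\<close>)
    also have "\<dots> = of_bool (D \<notin> {fst b - 1, fst b, fst b + 1})"
      unfolding sum_UNIV_prod by (simp add: route_rate_def)
    finally show ?thesis .
  qed
  have "(\<Sum>v | fst v \<noteq> snd v. route_rate D (v :: ('k, 'n) node \<times> ('k, 'n) node)) =
      real CARD('n) * (\<Sum>v\<in>UNIV. of_bool (D \<notin> {v - 1, v, v + 1}))"
    unfolding sum_off_diagonal inner sum_UNIV_prod by (simp only: fst_conv sum_constant sum_distrib_left)
  also have "(\<Sum>v\<in>UNIV. of_bool (D \<notin> {v - 1, v, v + 1}) :: real) = real (card (-{D + 1, D, D - 1}))"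
    by (subst sum_of_bool_eq) (auto intro!: arg_cong[of _ _ card])
  also have "card {D + 1, D, D - 1} = 3"
    using two by (auto simp: card_insert_if algebra_simps eq_diff_eq)
  then have "real (card (-{D + 1, D, D - 1})) = real CARD('k) - 3"
    using assms by (simp add: Compl_eq_Diff_UNIV card_Diff_subset of_nat_diff)
  finally show ?thesis .
qed

lemma network_corrector_exists:
  fixes p :: "'k::nontriv mod_ring pmf"
  assumes "0 < lam" "0 < beta" "3 \<le> CARD('k)" "3 / lam < real CARD('k)"
  obtains \<psi> :: "nat \<Rightarrow> 'k mod_ring \<Rightarrow> ('k, 'n::finite) node \<times> ('k, 'n) node \<Rightarrow> real" and B \<rho> c
  where "network_corrector lam beta \<psi> B \<rho> c"
proof -
  define M where "M = real CARD(('k, 'n) node)"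
  have M: "M = real CARD('k) * real CARD('n)" "1 < M"
  proof -
    show "M = real CARD('k) * real CARD('n)" by (simp add: M_def)
    moreover have "3 * 1 \<le> real CARD('k) * real CARD('n)"
      using assms(3) by (intro mult_mono) (auto simp: Suc_leI)
    ultimately show "1 < M" by simp
  qed
  \<comment> \<open>The average of \<open>route_rate\<close> over the M (M - 1) ordered pairs of
    distinct nodes, so that \<open>f D\<close> below has mean zero. Then (M - 1) c = (K - 3) / K,
    which yields the threshold 3 / \<open>lam\<close> for K.\<close>
  define c where "c = (real CARD('k) - 3) / (real CARD('k) * (M - 1))"
  define V where "V = {v :: ('k, 'n) node \<times> ('k, 'n) node. fst v \<noteq> snd v}"
  obtain d :: real where d: "0 < d"
    "\<And>g M v w. (\<And>i v. v \<in> V \<Longrightarrow> \<bar>g (pair_swap i v) - g v\<bar> \<le> M) \<Longrightarrow> v \<in> V \<Longrightarrow> w \<in> V \<Longrightarrow>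
      \<bar>g v - g w\<bar> \<le> d * M"
    unfolding V_def by (rule edge_swap_pairs_connected[OF cyc_edge_connected]) blast
  interpret connected_involution_walk "beta / real CARD('n)" pair_swap V d
  proof unfold_locales
    show "pair_swap i v \<in> V" if "v \<in> V" for i v
      using that unfolding V_def by (metis (mono_tags) edge_swap_involutory fst_map_prod mem_Collect_eq snd_map_prod)
  qed (use assms d in \<open>auto simp: edge_swap_involutory\<close>)
  define f where "f = (\<lambda>D (v :: ('k, 'n) node \<times> ('k, 'n) node). route_rate D v - c)"
  have sum_f: "(\<Sum>v\<in>V. f D v) = 0" for D
  proof -
    have "(\<Sum>v\<in>V. c) = M * (M - 1) * c"
      unfolding V_def sum_off_diagonal using M(2)
      by (simp add: Compl_eq_Diff_UNIV card_Diff_subset of_nat_diff Suc_leI M(1))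
    also have "\<dots> = real CARD('n) * (real CARD('k) - 3)"
      using M by (simp add: c_def)
    finally show ?thesis
      using sum_route_rate[OF assms(3), of D, where 'n='n] by (simp add: f_def V_def sum_subtractf)
  qed
  define \<psi> where "\<psi> = (\<lambda>j D. (resolvent ^^ j) (f D))"
  \<comment> \<open>The sum over all destinations makes the bound uniform in
    \<open>D\<close>.\<close>
  define B where "B = (\<Sum>D\<in>UNIV. L2_set (f D) V)"
  have "network_corrector lam beta \<psi> B (1 / (1 + gap)) c"
  proof
    show "\<bar>\<psi> j D (a, b)\<bar> \<le> B * (1 / (1 + gap)) ^ j" if "a \<noteq> b" for a b j D
    proof -
      have "\<bar>\<psi> j D (a, b)\<bar> \<le> L2_set (f D) V * (1 / (1 + gap)) ^ j"
        unfolding \<psi>_def by (rule resolvent_funpow[OF sum_f]) (use that in \<open>simp add: V_def\<close>)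
      also have "L2_set (f D) V \<le> B"
        unfolding B_def by (rule member_le_sum) auto
      finally show ?thesis using gap_pos by (simp add: mult_right_mono)
    qed
    have "(M - 1) * c = (real CARD('k) - 3) / real CARD('k)"
      using M by (simp add: c_def)
    moreover have "3 / real CARD('k) < lam"
      using assms by (simp add: field_simps)
    ultimately show "1 < lam + (real CARD(('k, 'n) node) - 1) * c"
      unfolding M_def[symmetric] by (simp add: diff_divide_distrib)
  qed (use assms gap_pos in \<open>auto simp: \<psi>_def resolvent f_def B_def intro!: sum_nonneg\<close>)
  then show thesis by (rule that)
qed

theorem theorem8:
  fixes lam beta :: real
    and p :: "'k::nontriv mod_ring pmf"
    and P :: "('k, 'n::finite) config \<Rightarrow> 'w measure"
    and X :: "real \<Rightarrow> 'w \<Rightarrow> ('k, 'n) config option"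
  assumes "0 < lam" and "0 < beta"
    and "CARD('k) \<ge> 3" and "odd CARD('k)" and "real CARD('k) > 3 / lam"
    and "markov_chain_with_rates (network_rate lam beta p) P X"
  shows "transient P X"
proof -
  obtain \<psi> :: "nat \<Rightarrow> 'k mod_ring \<Rightarrow> ('k, 'n) node \<times> ('k, 'n) node \<Rightarrow> real" and B \<rho> c
    where "network_corrector lam beta \<psi> B \<rho> c"
    using network_corrector_exists assms by blast
  then show ?thesis using assms(6) by (rule network_corrector.transient_network)
qed

end
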